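(* Let $G=(V,E,w)$ be a connected graph, let $\pi\in\mathscr{P}_\star(V)$ be the stationary distribution of the simple random walk on $V$, and let $\mu\in\mathscr{P}_\star(V)$ be fixed. Define edge weights $w^{(\mu)}=(w^{(\mu)}_{xy})_{\{x,y\}\in E}$ by $$w^{(\mu)}_{xy}:=w_{xy}\,\theta\left(\frac{\mu(x)}{\pi(x)},\frac{\mu(y)}{\pi(y)}\right),\quad\{x,y\}\in E,$$ and let $L_{w^{(\mu)}}$ be the corresponding Laplacian. Let $h\in\mathbb{R}^V_0$ be fixed with $\|h\|_2\le1$. Let $\lambda_2(L_{w^{(\mu)}})$ denote the smallest nonzero eigenvalue of $L_{w^{(\mu)}}$, and define constants $0<C\le C'$ via $$C:=\left(\min_{x\in V}\mu(x)\right)^{-1},\qquad C':=C\,\sqrt{\frac{2\,\mathrm{Vol}_w(G)}{\lambda_2(L_{w^{(\mu)}})}}.$$ Then for any $\varepsilon\in\mathbb{R}$ with $|\varepsilon|$ sufficiently small (depending only on $G$ and $\mu$), $$\frac{\varepsilon^2}{1+C'|\varepsilon|}\,h^\top L_{w^{(\mu)}}^\dagger h\ \le\ \mathcal{M}(\mu,\mu+\varepsilon h)^2\ \le\ \frac{\varepsilon^2}{1-C|\varepsilon|}\,h^\top L_{w^{(\mu)}}^\dagger h.$$ In particular, $\mathcal{M}(\mu,\mu+\varepsilon h)^2=|\varepsilon|^2\,h^\top L_{w^{(\mu)}}^\dagger h+o(|\varepsilon|^2)$ as $\varepsilon\to0$.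
   Context: A graph $G=(V,E,w)$ consists of a finite vertex set $V$, a set $E$ of $m\ge 1$ undirected edges (unordered pairs of distinct vertices), and positive edge weights $w=(w_{xy})_{\{x,y\}\in E}$ (with $w_{xy}=w_{yx}$). Write $y\sim x$ if $\{x,y\}\in E$. The degree of $x$ is $\mathrm{d}_x=\sum_{y\sim x}w_{xy}$; $D_w$ is the diagonal degree matrix, $A_w$ the weighted adjacency matrix, $L_w=D_w-A_w$ the Laplacian matrix (the same notation is used for any other positive edge weights on $E$), and $\mathrm{Vol}_w(G)=\sum_{x\in V}\mathrm{d}_x$. The simple random walk on $V$ is the Markov chain with transition matrix $P=D_w^{-1}A_w$; for connected $G$ its unique stationary distribution is $\pi(x)=\mathrm{d}_x/\mathrm{Vol}_w(G)$. $\mathscr{P}(V)$ is the simplex of probability densities on $V$ (nonnegative vectors in $\mathbb{R}^V$ with entries summing to $1$), and $\mathscr{P}_\star(V)$ is its interior (everywhere positive densities). $\mathbb{R}^V_0=\{f\in\mathbb{R}^V:\sum_{x}f(x)=0\}$. $X^\dagger$ is the Moore--Penrose inverse of a matrix $X$. The logarithmic mean is $\theta(a,b)=\int_0^1 a^{1-\lambda}b^\lambda\,d\lambda$ for $a,b\ge0$. Discrete transportation distance: for $\mu,\nu\in\mathscr{P}_\star(V)$, $$\mathcal{M}(\mu,\nu)^2=\inf \int_0^1\sum_{\{x,y\}\in E}w_{xy}(\psi_t(x)-\psi_t(y))^2\,\theta\left(\frac{\rho_t(x)}{\pi(x)},\frac{\rho_t(y)}{\pi(y)}\right)dt,$$ where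 the infimum is over all $\mathcal{C}^1$ curves $(\rho_t)_{t\in[0,1]}$ with values in $\mathscr{P}_\star(V)$ and all Borel measurable $(\psi_t)_{t\in[0,1]}$ with values in $\mathbb{R}^V$ such that $\rho_0=\mu$, $\rho_1=\nu$, and for all $x\in V$, $t\in[0,1]$, $$\frac{d}{dt}\rho_t(x)+\sum_{y\sim x}w_{xy}(\psi_t(y)-\psi_t(x))\,\theta\left(\frac{\rho_t(x)}{\pi(x)},\frac{\rho_t(y)}{\pi(y)}\right)=0.$$ *)

theory Defs
  imports "HOL-Analysis.Analysis" "HOL-Library.Landau_Symbols"
begin

section \<open>Weighted graphs\<close>

text \<open>
  The vertex set is the finite type \<open>'v\<close>, so vectors and matrices indexed by vertices are
  \<open>real^'v\<close> and \<open>real^'v^'v\<close>. An edge is a two-element set of vertices. The weight of the edge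
  \<open>{x, y}\<close> is \<open>w x y = w y x\<close>; values of \<open>w\<close> at non-edges are irrelevant.
\<close>

definition weighted_graph :: "'v::finite set set \<Rightarrow> ('v \<Rightarrow> 'v \<Rightarrow> real) \<Rightarrow> bool" where
  "weighted_graph E w \<longleftrightarrow> E \<noteq> {} \<and> (\<forall>e\<in>E. card e = 2) \<and>
     (\<forall>x y. {x, y} \<in> E \<longrightarrow> w x y = w y x \<and> w x y > 0)"

definition graph_connected :: "'v set set \<Rightarrow> bool" where
  "graph_connected E \<longleftrightarrow> (\<forall>x y. (x, y) \<in> {(u, v). {u, v} \<in> E}\<^sup>*)"

definition nbrs :: "'v set set \<Rightarrow> 'v \<Rightarrow> 'v set" where
  "nbrs E x = {y. {x, y} \<in> E}"

definition deg :: "'v::finite set set \<Rightarrow> ('v \<Rightarrow> 'v \<Rightarrow> real) \<Rightarrow> 'v \<Rightarrow> real" where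
  "deg E w x = (\<Sum>y\<in>nbrs E x. w x y)"

definition graph_vol :: "'v::finite set set \<Rightarrow> ('v \<Rightarrow> 'v \<Rightarrow> real) \<Rightarrow> real" where
  "graph_vol E w = (\<Sum>x\<in>UNIV. deg E w x)"

definition degree_matrix :: "'v::finite set set \<Rightarrow> ('v \<Rightarrow> 'v \<Rightarrow> real) \<Rightarrow> real^'v^'v" where
  "degree_matrix E w = (\<chi> x y. if x = y then deg E w x else 0)"

definition adjacency_matrix :: "'v::finite set set \<Rightarrow> ('v \<Rightarrow> 'v \<Rightarrow> real) \<Rightarrow> real^'v^'v" where
  "adjacency_matrix E w = (\<chi> x y. if {x, y} \<in> E then w x y else 0)"

definition laplacian :: "'v::finite set set \<Rightarrow> ('v \<Rightarrow> 'v \<Rightarrow> real) \<Rightarrow> real^'v^'v" where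
  "laplacian E w = degree_matrix E w - adjacency_matrix E w"

definition transition_matrix :: "'v::finite set set \<Rightarrow> ('v \<Rightarrow> 'v \<Rightarrow> real) \<Rightarrow> real^'v^'v" where
  "transition_matrix E w = matrix_inv (degree_matrix E w) ** adjacency_matrix E w"

section \<open>Densities\<close>

definition densities :: "(real^'v::finite) set" where
  "densities = {\<rho>. (\<forall>x. \<rho> $ x \<ge> 0) \<and> (\<Sum>x\<in>UNIV. \<rho> $ x) = 1}"

definition pos_densities :: "(real^'v::finite) set" where
  "pos_densities = {\<rho>\<in>densities. \<forall>x. \<rho> $ x > 0}"

definition zero_sum_vectors :: "(real^'v::finite) set" where
  "zero_sum_vectors = {f. (\<Sum>x\<in>UNIV. f $ x) = 0}"

definition stationary_distribution ::
    "'v::finite set set \<Rightarrow> ('v \<Rightarrow> 'v \<Rightarrow> real) \<Rightarrow> real^'v \<Rightarrow> bool" where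
  "stationary_distribution E w \<pi> \<longleftrightarrow> \<pi> \<in> densities \<and> \<pi> v* transition_matrix E w = \<pi>"

section \<open>Linear algebra\<close>

definition mat_eigenvalue :: "real^'n::finite^'n \<Rightarrow> real \<Rightarrow> bool" where
  "mat_eigenvalue A l \<longleftrightarrow> (\<exists>v. v \<noteq> 0 \<and> A *v v = l *\<^sub>R v)"

definition min_nonzero_eigenvalue :: "real^'n::finite^'n \<Rightarrow> real" where
  "min_nonzero_eigenvalue A = (LEAST l. l \<noteq> 0 \<and> mat_eigenvalue A l)"

definition is_pinv :: "real^'n::finite^'m::finite \<Rightarrow> real^'m^'n \<Rightarrow> bool" where
  "is_pinv A X \<longleftrightarrow> A ** X ** A = A \<and> X ** A ** X = X \<and>
     transpose (A ** X) = A ** X \<and> transpose (X ** A) = X ** A"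

definition pinv :: "real^'n::finite^'m::finite \<Rightarrow> real^'m^'n" where
  "pinv A = (THE X. is_pinv A X)"

section \<open>The discrete transportation distance\<close>

definition log_mean :: "real \<Rightarrow> real \<Rightarrow> real" where
  "log_mean a b = integral {0..1} (\<lambda>l. a powr (1 - l) * b powr l)"

text \<open>The edge weights \<open>w x y * \<theta> (\<rho> x / \<pi> x) (\<rho> y / \<pi> y)\<close>, with \<open>\<theta>\<close> the logarithmic mean.\<close>

definition tilted_weights ::
    "('v::finite \<Rightarrow> 'v \<Rightarrow> real) \<Rightarrow> real^'v \<Rightarrow> real^'v \<Rightarrow> 'v \<Rightarrow> 'v \<Rightarrow> real" where
  "tilted_weights w \<pi> \<rho> x y = w x y * log_mean (\<rho> $ x / \<pi> $ x) (\<rho> $ y / \<pi> $ y)"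

text \<open>
  \<open>\<rho>'\<close> is the derivative of the curve \<open>\<rho>\<close> on \<open>[0, 1]\<close> (one-sided at the end points); its
  continuity makes \<open>\<rho>\<close> a C1 curve.
\<close>

definition admissible ::
    "'v::finite set set \<Rightarrow> ('v \<Rightarrow> 'v \<Rightarrow> real) \<Rightarrow> real^'v \<Rightarrow> real^'v \<Rightarrow> real^'v
      \<Rightarrow> ((real \<Rightarrow> real^'v) \<times> (real \<Rightarrow> real^'v)) set" where
  "admissible E w \<pi> \<mu> \<nu> = {(\<rho>, \<psi>).
     (\<forall>t\<in>{0..1}. \<rho> t \<in> pos_densities) \<and> \<rho> 0 = \<mu> \<and> \<rho> 1 = \<nu> \<and>
     \<psi> \<in> borel_measurable (restrict_space borel {0..1}) \<and>
     (\<exists>\<rho>'. continuous_on {0..1} \<rho>' \<and>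
       (\<forall>t\<in>{0..1}. (\<rho> has_vector_derivative \<rho>' t) (at t within {0..1}) \<and>
         (\<forall>x. \<rho>' t $ x
            + (\<Sum>y\<in>nbrs E x. w x y * (\<psi> t $ y - \<psi> t $ x)
                 * log_mean (\<rho> t $ x / \<pi> $ x) (\<rho> t $ y / \<pi> $ y)) = 0)))}"

text \<open>The factor \<open>1/2\<close> compensates for counting each edge in both orientations.\<close>

definition action_density ::
    "'v::finite set set \<Rightarrow> ('v \<Rightarrow> 'v \<Rightarrow> real) \<Rightarrow> real^'v \<Rightarrow> real^'v \<Rightarrow> real^'v \<Rightarrow> real" where
  "action_density E w \<pi> \<rho> \<psi> =
     1/2 * (\<Sum>x\<in>UNIV. \<Sum>y\<in>nbrs E x. w x y * (\<psi> $ x - \<psi> $ y)\<^sup>2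
               * log_mean (\<rho> $ x / \<pi> $ x) (\<rho> $ y / \<pi> $ y))"

text \<open>
  Values are extended nonnegative reals because the action of an admissible pair may be infinite;
  the infimum over an empty set of pairs is \<open>\<infinity>\<close>.
\<close>

definition transport_cost ::
    "'v::finite set set \<Rightarrow> ('v \<Rightarrow> 'v \<Rightarrow> real) \<Rightarrow> real^'v \<Rightarrow> real^'v \<Rightarrow> real^'v \<Rightarrow> ennreal" where
  "transport_cost E w \<pi> \<mu> \<nu> =
     (INF (\<rho>, \<psi>)\<in>admissible E w \<pi> \<mu> \<nu>.
        \<integral>\<^sup>+t\<in>{0..1}. ennreal (action_density E w \<pi> (\<rho> t) (\<psi> t)) \<partial>lborel)"

definition transport_dist ::
    "'v::finite set set \<Rightarrow> ('v \<Rightarrow> 'v \<Rightarrow> real) \<Rightarrow> real^'v \<Rightarrow> real^'v \<Rightarrow> real^'v \<Rightarrow> ennreal" where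
  "transport_dist E w \<pi> \<mu> \<nu> =
     (let c = transport_cost E w \<pi> \<mu> \<nu>
      in if c = \<infinity> then \<infinity> else ennreal (sqrt (enn2real c)))"

lemma transport_dist_square: "(transport_dist E w \<pi> \<mu> \<nu>)\<^sup>2 = transport_cost E w \<pi> \<mu> \<nu>"
proof (cases "transport_cost E w \<pi> \<mu> \<nu>" rule: ennreal_cases)
  case (real r)
  then show ?thesis by (simp add: transport_dist_def ennreal_power)
next
  case top
  then show ?thesis by (simp add: transport_dist_def power2_eq_square ennreal_mult_top)
qed

end

theory Submission
  imports Defs
begin

text \<open>
  The continuity equation says \<open>\<rho>' = L\<^sub>\<rho> \<psi>\<close> and the action density is \<open>\<psi> \<bullet> L\<^sub>\<rho> \<psi>\<close>, where \<open>L\<^sub>\<rho>\<close> is the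
  Laplacian of the weights tilted by \<open>\<rho>\<close>. The logarithmic mean is monotone and homogeneous, so
  \<open>\<rho> \<le> c \<mu>\<close> implies \<open>L\<^sub>\<rho> \<le> c L\<^sub>\<mu>\<close>, and conversely for lower bounds. For the upper bound one moves along the
  straight line from \<open>\<mu>\<close> to \<open>\<mu> + \<epsilon> h\<close>. For the lower bound one pairs the continuity equation
  with the potential \<open>L\<^sub>\<mu>\<^sup>\<dagger> h\<close> as long as the curve stays close to \<open>\<mu>\<close>; a curve that leaves the
  neighbourhood is too expensive, because the diagonal entries of \<open>L\<^sub>\<rho>\<close> are at most \<open>Vol / 2\<close>.
\<close>

section \<open>The logarithmic mean\<close>

lemma log_mean_integrable:
  assumes "0 < a" "0 < b"
  shows "(\<lambda>l. a powr (1 - l) * b powr l) integrable_on {0..1::real}"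
  by (intro integrable_continuous_real continuous_intros) (use assms in auto)

lemma log_mean_mono:
  assumes "0 < a" "0 < b" "a \<le> a'" "b \<le> b'"
  shows "log_mean a b \<le> log_mean a' b'"
  unfolding log_mean_def using assms
  by (intro integral_le log_mean_integrable mult_mono powr_mono2) auto

text \<open>The exponents \<open>1 - l\<close> and \<open>l\<close> add up to 1, so the factor
  \<open>c\<close> leaves the integrand.\<close>

lemma log_mean_scale:
  assumes "0 < c" "0 < a" "0 < b"
  shows "log_mean (c * a) (c * b) = c * log_mean a b"
proof -
  have "log_mean (c * a) (c * b) = integral {0..1} (\<lambda>l. c * (a powr (1 - l) * b powr l))"
    unfolding log_mean_def
  proof (rule integral_cong)
    fix l :: real
    have "c powr (1 - l) * c powr l = c"
      using assms by (simp flip: powr_add)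
    then show "(c * a) powr (1 - l) * (c * b) powr l = c * (a powr (1 - l) * b powr l)"
      using assms by (simp add: powr_mult algebra_simps)
  qed
  then show ?thesis
    by (simp add: log_mean_def)
qed

lemma log_mean_refl:
  assumes "0 < a"
  shows "log_mean a a = a"
  using assms by (simp add: log_mean_def flip: powr_add)

text \<open>Monotonicity compares with the diagonal value at \<open>min a b\<close>, which is
  \<open>min a b\<close> itself.\<close>

lemma log_mean_pos:
  assumes "0 < a" "0 < b"
  shows "0 < log_mean a b"
  using log_mean_mono[of "min a b" "min a b" a b] log_mean_refl[of "min a b"] assms by simp

text \<open>The substitution of \<open>1 - l\<close> for \<open>l\<close> exchanges the two
  exponents. This symmetry makes the tilted weights well defined on unordered edges.\<close>

lemma log_mean_commute:
  assumes "0 < a" "0 < b"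
  shows "log_mean a b = log_mean b a"
proof -
  have "((\<lambda>l. f (1 - l)) has_integral i) {0..1}" if "(f has_integral i) {0..1}" for f :: "real \<Rightarrow> real" and i
    using has_integral_affinity[of f i 0 1 "-1" 1] that by simp
  then have "f integrable_on {0..1} \<Longrightarrow> integral {0..1} (\<lambda>l. f (1 - l)) = integral {0..1} f"
    for f :: "real \<Rightarrow> real"
    by (metis has_integral_integral integral_unique)
  from this[OF log_mean_integrable[OF assms(2,1)]] show ?thesis
    by (simp add: log_mean_def mult.commute)
qed

text \<open>Weighted AM-GM holds for each \<open>l\<close>, and the linear interpolation between
  \<open>a\<close> and \<open>b\<close> has mean \<open>(a + b) / 2\<close>. The estimate bounds the
  diagonal of a tilted Laplacian uniformly over all densities.\<close>

lemma log_mean_le_arith_mean: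
  assumes "0 < a" "0 < b"
  shows "log_mean a b \<le> (a + b) / 2"
proof -
  have "((\<lambda>l. (1 - l) * a + l * b) has_integral
          ((1 * a - 1\<^sup>2 / 2 * a + 1\<^sup>2 / 2 * b) - (0 * a - 0\<^sup>2 / 2 * a + 0\<^sup>2 / 2 * b))) {0..1::real}"
    by (rule fundamental_theorem_of_calculus)
      (auto intro!: derivative_eq_intros simp: algebra_simps
        simp flip: has_real_derivative_iff_has_vector_derivative)
  then have I: "((\<lambda>l. (1 - l) * a + l * b) has_integral (a + b) / 2) {0..1::real}"
    by (simp add: field_simps)
  have "log_mean a b \<le> integral {0..1} (\<lambda>l. (1 - l) * a + l * b)"
    unfolding log_mean_def
  proof (rule integral_le)
    show "(\<lambda>l. (1 - l) * a + l * b) integrable_on {0..1}"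
      using I by blast
    fix l :: real assume "l \<in> {0..1}"
    then show "a powr (1 - l) * b powr l \<le> (1 - l) * a + l * b"
      using Youngs_inequality_0[of "1 - l" l a b] assms by simp
  qed (rule log_mean_integrable[OF assms])
  then show ?thesis
    using I by (simp add: integral_unique)
qed

text \<open>The integrand is jointly continuous on \<open>S \<times> {0..1}\<close>, so its
  parameter integral is continuous. This gives continuity in time of the weights tilted along a
  curve.\<close>

lemma continuous_on_log_mean:
  fixes f g :: "real \<Rightarrow> real"
  assumes "continuous_on S f" "continuous_on S g" "\<And>x. x \<in> S \<Longrightarrow> 0 < f x" "\<And>x. x \<in> S \<Longrightarrow> 0 < g x"
  shows "continuous_on S (\<lambda>x. log_mean (f x) (g x))"
proof -
  have "continuous_on (S \<times> {0..1}) (\<lambda>p. f (fst p))" "continuous_on (S \<times> {0..1}) (\<lambda>p. g (fst p))"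
    by (rule continuous_on_compose2[OF assms(1)] continuous_on_compose2[OF assms(2)];
        force intro: continuous_intros)+
  moreover have "f (fst p) \<noteq> 0" "g (fst p) \<noteq> 0" if "p \<in> S \<times> {0..1}" for p :: "real \<times> real"
    using assms(3,4)[of "fst p"] that by auto
  ultimately have "continuous_on (S \<times> {0..1}) (\<lambda>p. f (fst p) powr (1 - snd p) * g (fst p) powr (snd p))"
    by (intro continuous_on_mult continuous_on_powr continuous_on_diff continuous_on_snd
        continuous_on_id continuous_on_const) auto
  then have "continuous_on (S \<times> cbox 0 1) (\<lambda>(x, l). f x powr (1 - l) * g x powr l)"
    by (simp add: case_prod_unfold)
  from integral_continuous_on_param[OF this] show ?thesis
    by (simp add: log_mean_def)
qed

section \<open>Weighted Laplacians\<close>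

lemma nbrs_commute: "y \<in> nbrs E x \<longleftrightarrow> x \<in> nbrs E y"
  by (simp add: nbrs_def insert_commute)

lemma weighted_graph_sym: "weighted_graph E k \<Longrightarrow> y \<in> nbrs E x \<Longrightarrow> k x y = k y x"
  and weighted_graph_pos: "weighted_graph E k \<Longrightarrow> y \<in> nbrs E x \<Longrightarrow> 0 < k x y"
  unfolding weighted_graph_def nbrs_def by blast+

lemma weighted_graph_irrefl:
  assumes "weighted_graph E k"
  shows "x \<notin> nbrs E x"
  using assms by (force simp: weighted_graph_def nbrs_def)

lemma sum_nbrs: "(\<Sum>y\<in>nbrs E x. f y) = (\<Sum>y\<in>UNIV. if {x, y} \<in> E then f y else 0)"
  for E :: "'v::finite set set"
  by (simp add: nbrs_def sum.If_cases)

text \<open>The double sum runs over all oriented edges, and reversing the orientation permutes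
  them.\<close>

lemma sum_nbrs_swap:
  fixes f :: "'v::finite \<Rightarrow> 'v \<Rightarrow> 'a::comm_monoid_add"
  shows "(\<Sum>x\<in>UNIV. \<Sum>y\<in>nbrs E x. f x y) = (\<Sum>x\<in>UNIV. \<Sum>y\<in>nbrs E x. f y x)"
  unfolding sum_nbrs by (subst sum.swap) (simp add: insert_commute)

lemma laplacian_mult_component:
  "(laplacian E k *v v) $ x = (\<Sum>y\<in>nbrs E x. k x y * (v $ x - v $ y))"
proof -
  have "(laplacian E k *v v) $ x
      = (\<Sum>y\<in>UNIV. (if x = y then deg E k x * v $ y else 0) - (if {x, y} \<in> E then k x y * v $ y else 0))"
    by (auto simp: laplacian_def degree_matrix_def adjacency_matrix_def matrix_vector_mult_def
        left_diff_distrib intro!: sum.cong)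
  also have "\<dots> = deg E k x * v $ x - (\<Sum>y\<in>nbrs E x. k x y * v $ y)"
    by (simp add: sum_subtractf sum_nbrs)
  finally show ?thesis
    by (simp add: deg_def sum_distrib_right right_diff_distrib sum_subtractf)
qed

text \<open>Summation by parts: the sum over oriented edges is averaged with its
  orientation-reversed copy.\<close>

lemma inner_laplacian:
  assumes "weighted_graph E k"
  shows "u \<bullet> (laplacian E k *v v)
       = 1/2 * (\<Sum>x\<in>UNIV. \<Sum>y\<in>nbrs E x. k x y * ((u $ x - u $ y) * (v $ x - v $ y)))"
proof -
  have *: "u \<bullet> (laplacian E k *v v) = (\<Sum>x\<in>UNIV. \<Sum>y\<in>nbrs E x. u $ x * (k x y * (v $ x - v $ y)))"
    by (simp add: inner_vec_def laplacian_mult_component sum_distrib_left)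
  also have "\<dots> = (\<Sum>x\<in>UNIV. \<Sum>y\<in>nbrs E x. u $ y * (k x y * (v $ y - v $ x)))"
    by (subst sum_nbrs_swap) (intro sum.cong refl, metis weighted_graph_sym[OF assms])
  finally have "2 * (u \<bullet> (laplacian E k *v v))
      = (\<Sum>x\<in>UNIV. \<Sum>y\<in>nbrs E x. u $ x * (k x y * (v $ x - v $ y)) + u $ y * (k x y * (v $ y - v $ x)))"
    using * by (simp add: sum.distrib)
  also have "\<dots> = (\<Sum>x\<in>UNIV. \<Sum>y\<in>nbrs E x. k x y * ((u $ x - u $ y) * (v $ x - v $ y)))"
    by (simp add: algebra_simps)
  finally show ?thesis by simp
qed

lemma inner_laplacian_self:
  assumes "weighted_graph E k"
  shows "v \<bullet> (laplacian E k *v v) = 1/2 * (\<Sum>x\<in>UNIV. \<Sum>y\<in>nbrs E x. k x y * (v $ x - v $ y)\<^sup>2)"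
  by (simp add: inner_laplacian[OF assms] power2_eq_square)

lemma inner_laplacian_commute:
  assumes "weighted_graph E k"
  shows "u \<bullet> (laplacian E k *v v) = v \<bullet> (laplacian E k *v u)"
  by (simp add: inner_laplacian[OF assms] mult.commute)

lemma inner_laplacian_nonneg:
  assumes "weighted_graph E k"
  shows "0 \<le> v \<bullet> (laplacian E k *v v)"
  unfolding inner_laplacian_self[OF assms]
  by (intro mult_nonneg_nonneg sum_nonneg) (auto dest: weighted_graph_pos[OF assms])

lemma inner_laplacian_mono:
  assumes "weighted_graph E k" "weighted_graph E k'"
    and le: "\<And>x y. y \<in> nbrs E x \<Longrightarrow> k x y \<le> c * k' x y"
  shows "v \<bullet> (laplacian E k *v v) \<le> c * (v \<bullet> (laplacian E k' *v v))"
proof -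
  have "(\<Sum>x\<in>UNIV. \<Sum>y\<in>nbrs E x. k x y * (v $ x - v $ y)\<^sup>2)
      \<le> (\<Sum>x\<in>UNIV. \<Sum>y\<in>nbrs E x. (c * k' x y) * (v $ x - v $ y)\<^sup>2)"
    by (intro sum_mono mult_right_mono le) auto
  also have "\<dots> = c * (\<Sum>x\<in>UNIV. \<Sum>y\<in>nbrs E x. k' x y * (v $ x - v $ y)\<^sup>2)"
    by (simp add: sum_distrib_left mult.assoc)
  finally show ?thesis
    by (simp add: inner_laplacian_self assms(1,2))
qed

text \<open>Expand the nonnegative quadratic form at \<open>s *\<^sub>R u - v\<close>.\<close>

lemma inner_laplacian_Young:
  assumes "weighted_graph E k"
  shows "2 * (s * (u \<bullet> (laplacian E k *v v)))
       \<le> s\<^sup>2 * (u \<bullet> (laplacian E k *v u)) + v \<bullet> (laplacian E k *v v)"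
proof -
  have "0 \<le> (s *\<^sub>R u - v) \<bullet> (laplacian E k *v (s *\<^sub>R u - v))"
    by (rule inner_laplacian_nonneg[OF assms])
  also have "\<dots> = s\<^sup>2 * (u \<bullet> (laplacian E k *v u)) - 2 * (s * (u \<bullet> (laplacian E k *v v)))
      + v \<bullet> (laplacian E k *v v)"
    using inner_laplacian_commute[OF assms, of u v]
    by (simp add: matrix_vector_mult_diff_distrib matrix_vector_mult_scaleR inner_diff_left
        inner_diff_right power2_eq_square algebra_simps)
  finally show ?thesis by simp
qed

text \<open>Pair with the all-ones vector, whose differences along edges vanish.\<close>

lemma laplacian_mult_zero_sum:
  assumes "weighted_graph E k"
  shows "laplacian E k *v v \<in> zero_sum_vectors"
proof -
  have "(1::real^_) \<bullet> (laplacian E k *v v) = 0"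
    by (simp add: inner_laplacian[OF assms])
  then show ?thesis
    by (simp add: zero_sum_vectors_def inner_vec_def)
qed

text \<open>Every edge term is nonnegative, so each one vanishes and \<open>v\<close> agrees at the
  two ends of every edge. Induction along a path extends this to all pairs of vertices.\<close>

lemma laplacian_form_zero_imp_constant:
  assumes wg: "weighted_graph E k" and "graph_connected E"
    and zero: "v \<bullet> (laplacian E k *v v) = 0"
  shows "v $ x = v $ y"
proof -
  have nn: "0 \<le> k x y * (v $ x - v $ y)\<^sup>2" if "y \<in> nbrs E x" for x y
    using weighted_graph_pos[OF wg that] by simp
  have "(\<Sum>y\<in>nbrs E x. k x y * (v $ x - v $ y)\<^sup>2) = 0" for x
    using zero nn unfolding inner_laplacian_self[OF wg]
    by (simp add: sum_nonneg_eq_0_iff sum_nonneg)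
  then have edge: "v $ x = v $ y" if "y \<in> nbrs E x" for x y
    using nn weighted_graph_pos[OF wg that] that
    by (subst (asm) sum_nonneg_eq_0_iff) fastforce+
  have "(x, y) \<in> {(u, v). {u, v} \<in> E}\<^sup>*"
    using assms(2) by (simp add: graph_connected_def)
  then show ?thesis
  proof induction
    case (step y z)
    then show ?case using edge[of z y] by (simp add: nbrs_def)
  qed simp
qed

text \<open>A vector with vanishing form is constant, and the only constant zero-sum vector is
  0.\<close>

lemma laplacian_form_zero_iff:
  assumes "weighted_graph E k" "graph_connected E" "v \<in> zero_sum_vectors"
  shows "v \<bullet> (laplacian E k *v v) = 0 \<longleftrightarrow> v = 0"
proof
  assume "v \<bullet> (laplacian E k *v v) = 0"
  then have const: "v $ x = v $ y" for x y
    using laplacian_form_zero_imp_constant[OF assms(1,2)] by blast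
  have "v $ x = 0" for x
  proof -
    have "(\<Sum>y\<in>UNIV. v $ y) = of_nat CARD('a) * v $ x"
      using const[of _ x] by (subst sum.cong[OF refl const[of _ x]]) simp_all
    then show ?thesis
      using assms(3) by (simp add: zero_sum_vectors_def)
  qed
  then show "v = 0"
    by (simp add: vec_eq_iff)
qed simp

section \<open>Degrees and the stationary distribution\<close>

lemma nbrs_nonempty:
  assumes "weighted_graph E k" "graph_connected E"
  shows "nbrs E x \<noteq> {}"
proof -
  obtain e where "e \<in> E" "card e = 2"
    using assms(1) by (auto simp: weighted_graph_def)
  then obtain z where "z \<noteq> x"
    by (metis card_2_iff)
  \<comment> \<open>The first step of a path from \<open>x\<close> to the different vertex
    \<open>z\<close> leads to a neighbour of \<open>x\<close>.\<close>
  moreover have "(x, z) \<in> {(u, v). {u, v} \<in> E}\<^sup>*"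
    using assms(2) by (simp add: graph_connected_def)
  ultimately show ?thesis
    by (auto simp: nbrs_def elim: converse_rtranclE)
qed

lemma deg_pos:
  assumes "weighted_graph E k" "graph_connected E"
  shows "0 < deg E k x"
  unfolding deg_def
  by (rule sum_pos) (use nbrs_nonempty[OF assms] weighted_graph_pos[OF assms(1)] in auto)

lemma graph_vol_pos:
  assumes "weighted_graph E k" "graph_connected E"
  shows "0 < graph_vol E k"
  unfolding graph_vol_def by (rule sum_pos) (use deg_pos[OF assms] in auto)

lemma matrix_inv_degree_matrix:
  assumes "weighted_graph E k" "graph_connected E"
  shows "matrix_inv (degree_matrix E k) = (\<chi> x y. if x = y then inverse (deg E k x) else 0)"
    (is "_ = ?D")
proof -
  have D: "degree_matrix E k ** ?D = mat 1" "?D ** degree_matrix E k = mat 1"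
    using deg_pos[OF assms, THEN less_imp_neq]
    by (auto simp: degree_matrix_def matrix_matrix_mult_def mat_def vec_eq_iff mult_delta_left)
  show ?thesis
    unfolding matrix_inv_def
  \<comment> \<open>\<open>matrix_inv\<close> is a choice operator, so uniqueness of the two-sided
    inverse is what identifies its value.\<close>
  proof (rule some_equality)
    fix B assume B: "degree_matrix E k ** B = mat 1 \<and> B ** degree_matrix E k = mat 1"
    have "B = (?D ** degree_matrix E k) ** B"
      by (simp only: D matrix_mul_lid)
    also have "\<dots> = ?D"
      using B by (simp only: matrix_mul_assoc[symmetric] matrix_mul_rid)
    finally show "B = ?D" .
  qed (simp only: D)
qed

text \<open>With \<open>r = \<pi> / d\<close> stationarity reads \<open>L r = 0\<close>, so \<open>r\<close> is constant.\<close>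

lemma stationary_distribution_eq:
  assumes wg: "weighted_graph E w" and con: "graph_connected E"
    and "stationary_distribution E w \<pi>"
  shows "\<pi> $ x = deg E w x / graph_vol E w"
proof -
  define r where "r = (\<chi> x. \<pi> $ x / deg E w x)"
  have d: "deg E w x \<noteq> 0" for x
    using deg_pos[OF wg con] by (metis less_irrefl)
  have \<pi>: "\<pi> $ x = deg E w x * r $ x" for x
    using d by (simp add: r_def)
  have T: "transition_matrix E w = (\<chi> x y. if {x, y} \<in> E then w x y / deg E w x else 0)"
    by (auto simp: transition_matrix_def matrix_inv_degree_matrix[OF wg con] adjacency_matrix_def
        matrix_matrix_mult_def vec_eq_iff mult_delta_left divide_inverse mult.commute)
  have "(\<Sum>x\<in>nbrs E y. w x y * r $ x) = \<pi> $ y" for y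
  proof -
    have "\<pi> $ y = (\<pi> v* transition_matrix E w) $ y"
      using assms(3) by (simp add: stationary_distribution_def)
    also have "\<dots> = (\<Sum>x\<in>nbrs E y. w x y * r $ x)"
      by (auto simp: vector_matrix_mult_def T sum_nbrs r_def insert_commute intro!: sum.cong)
    finally show ?thesis by simp
  qed
  then have "(\<Sum>x\<in>nbrs E y. w y x * r $ x) = deg E w y * r $ y" for y
    by (simp add: \<pi> weighted_graph_sym[OF wg] cong: sum.cong)
  then have "laplacian E w *v r = 0"
    by (simp add: vec_eq_iff laplacian_mult_component right_diff_distrib sum_subtractf
        deg_def sum_distrib_right)
  then have const: "r $ x = r $ y" for x y
    by (intro laplacian_form_zero_imp_constant[OF wg con]) simp
  have "1 = (\<Sum>y\<in>UNIV. \<pi> $ y)"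
    using assms(3) by (simp add: stationary_distribution_def densities_def)
  also have "\<dots> = graph_vol E w * r $ x"
    unfolding graph_vol_def sum_distrib_right by (intro sum.cong refl) (metis \<pi> const)
  finally show ?thesis
    using graph_vol_pos[OF wg con] by (simp add: \<pi> field_simps)
qed

section \<open>Spectral gap and pseudoinverse\<close>

lemma zero_sum_subspace: "subspace zero_sum_vectors"
  by (auto simp: subspace_def zero_sum_vectors_def sum.distrib simp flip: sum_distrib_left)

lemmas zero_sum_scale = subspace_scale[OF zero_sum_subspace]
lemmas zero_sum_add = subspace_add[OF zero_sum_subspace]
lemmas zero_sum_diff = subspace_diff[OF zero_sum_subspace]

lemma closed_zero_sum: "closed zero_sum_vectors"
  by (rule closed_subspace[OF zero_sum_subspace])

text \<open>The minimum of the Rayleigh quotient over zero-sum vectors is attained; its minimizer is an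
  eigenvector because perturbing it in the direction of the residual cannot decrease the form.\<close>

lemma laplacian_least_eigenvalue:
  fixes k :: "'v::finite \<Rightarrow> 'v \<Rightarrow> real"
  assumes wg: "weighted_graph E k" and con: "graph_connected E"
  shows min_nonzero_eigenvalue_pos: "0 < min_nonzero_eigenvalue (laplacian E k)"
    and min_nonzero_eigenvalue_le: "v \<in> zero_sum_vectors \<Longrightarrow>
      min_nonzero_eigenvalue (laplacian E k) * (v \<bullet> v) \<le> v \<bullet> (laplacian E k *v v)"
proof -
  define L where "L = laplacian E k"
  define S where "S = sphere 0 1 \<inter> (zero_sum_vectors :: (real^'v) set)"
  have "compact S"
    unfolding S_def by (intro compact_Int_closed compact_sphere closed_zero_sum)
  moreover have "S \<noteq> {}"
  proof -
    obtain x :: 'v and y where "y \<in> nbrs E x"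
      using nbrs_nonempty[OF wg con] by blast
    then have "x \<noteq> y"
      using weighted_graph_irrefl[OF wg] by blast
    \<comment> \<open>Normalizing this difference of two unit vectors shows that \<open>S\<close> is
      nonempty.\<close>
    define z :: "real^'v" where "z = axis x 1 - axis y 1"
    have "z \<in> zero_sum_vectors"
      by (simp add: z_def zero_sum_vectors_def sum_subtractf axis_def)
    moreover have "z \<noteq> 0"
      using \<open>x \<noteq> y\<close> by (simp add: z_def axis_eq_axis)
    ultimately have "inverse (norm z) *\<^sub>R z \<in> S"
      by (simp add: S_def zero_sum_scale)
    then show ?thesis by blast
  qed
  moreover have "continuous_on S (\<lambda>v. v \<bullet> (L *v v))"
    by (intro continuous_intros matrix_vector_mult_linear_continuous_on)
  ultimately obtain v0 where v0: "v0 \<in> S" and min: "\<And>v. v \<in> S \<Longrightarrow> v0 \<bullet> (L *v v0) \<le> v \<bullet> (L *v v)"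
    using continuous_attains_inf by metis
  define m where "m = v0 \<bullet> (L *v v0)"
  have v0': "v0 \<in> zero_sum_vectors" "v0 \<bullet> v0 = 1" "v0 \<noteq> 0"
    using v0 by (auto simp: S_def norm_eq_1)
  have m_pos: "0 < m"
    using inner_laplacian_nonneg[OF wg, of v0] laplacian_form_zero_iff[OF wg con v0'(1)] v0'(3)
    by (simp add: m_def L_def)
  have rayleigh: "m * (v \<bullet> v) \<le> v \<bullet> (L *v v)" if "v \<in> zero_sum_vectors" for v
  proof (cases "v = 0")
    case False
    then have "inverse (norm v) *\<^sub>R v \<in> S"
      using that by (simp add: S_def zero_sum_scale)
    then have "m \<le> (inverse (norm v) *\<^sub>R v) \<bullet> (L *v (inverse (norm v) *\<^sub>R v))"
      unfolding m_def by (rule min)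
    also have "\<dots> = (v \<bullet> (L *v v)) / (v \<bullet> v)"
      by (simp add: matrix_vector_mult_scaleR dot_square_norm power2_eq_square divide_inverse)
    finally show ?thesis
      using False by (simp add: field_simps)
  qed simp
  have "L *v v0 = m *\<^sub>R v0"
  proof -
    define u where "u = L *v v0 - m *\<^sub>R v0"
    have uz: "u \<in> zero_sum_vectors"
      unfolding u_def using laplacian_mult_zero_sum[OF wg, of v0] v0'(1)
      by (simp add: L_def zero_sum_diff zero_sum_scale)
    define q where "q = u \<bullet> (L *v u) - m * (u \<bullet> u)"
    have uLv: "u \<bullet> (L *v v0) = v0 \<bullet> (L *v u)"
      unfolding L_def by (rule inner_laplacian_commute[OF wg])
    have uu: "u \<bullet> u = u \<bullet> (L *v v0) - m * (u \<bullet> v0)"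
      by (metis (no_types) u_def inner_diff_right inner_scaleR_right)
    \<comment> \<open>This is the Rayleigh bound at \<open>v0 + s *\<^sub>R u\<close>: the terms
      without \<open>s\<close> cancel, and by symmetry of \<open>L\<close> the linear coefficient is
      twice the squared norm of the residual.\<close>
    have quad: "0 \<le> 2 * s * (u \<bullet> u) + s\<^sup>2 * q" for s
    proof -
      have "v0 + s *\<^sub>R u \<in> zero_sum_vectors"
        using uz v0'(1) by (simp add: zero_sum_add zero_sum_scale)
      from rayleigh[OF this]
      have "m * (v0 \<bullet> v0 + 2 * s * (u \<bullet> v0) + s\<^sup>2 * (u \<bullet> u))
          \<le> m + 2 * s * (u \<bullet> (L *v v0)) + s\<^sup>2 * (u \<bullet> (L *v u))"
        using uLv
        by (simp add: m_def matrix_vector_right_distrib matrix_vector_mult_scaleR inner_add_left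
            inner_add_right inner_commute[of v0 u] power2_eq_square algebra_simps)
      moreover have "2 * s * (u \<bullet> u) = 2 * s * (u \<bullet> (L *v v0)) - 2 * s * (m * (u \<bullet> v0))"
        unfolding uu by (simp add: right_diff_distrib)
      ultimately show ?thesis
        by (simp add: q_def v0'(2) algebra_simps)
    qed
    have "u \<bullet> u = 0"
    proof (rule ccontr)
      assume "u \<bullet> u \<noteq> 0"
      then have pos: "0 < u \<bullet> u"
        by simp
      \<comment> \<open>With this \<open>s\<close> the majorant
        \<open>s\<^sup>2 * (\<bar>q\<bar> + 1)\<close> of the quadratic term cancels exactly half of
        the negative linear term. Adding 1 keeps the denominator positive.\<close>
      define s where "s = - (u \<bullet> u) / (\<bar>q\<bar> + 1)"
      have "2 * s * (u \<bullet> u) + s\<^sup>2 * q \<le> 2 * s * (u \<bullet> u) + s\<^sup>2 * (\<bar>q\<bar> + 1)"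
        by (intro add_left_mono mult_left_mono) auto
      also have "\<dots> = s * (u \<bullet> u)"
      proof -
        have "s * (\<bar>q\<bar> + 1) = - (u \<bullet> u)"
          by (simp add: s_def)
        then have "s\<^sup>2 * (\<bar>q\<bar> + 1) = s * - (u \<bullet> u)"
          by (metis power2_eq_square mult.assoc)
        then show ?thesis by simp
      qed
      also have "\<dots> < 0"
        using pos by (simp add: s_def field_simps)
      finally show False
        using quad[of s] by simp
    qed
    then show ?thesis
      by (simp add: u_def)
  qed
  then have "mat_eigenvalue L m"
    using v0'(3) by (auto simp: mat_eigenvalue_def)
  \<comment> \<open>An eigenvector for a nonzero eigenvalue is a multiple of its image under
    \<open>L\<close>, hence zero-sum, and the Rayleigh bound applies to it.\<close>
  moreover have "m \<le> l" if l: "l \<noteq> 0" "mat_eigenvalue L l" for l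
  proof -
    obtain v where v: "v \<noteq> 0" "L *v v = l *\<^sub>R v"
      using l(2) by (auto simp: mat_eigenvalue_def)
    have "l *\<^sub>R v \<in> zero_sum_vectors"
      using laplacian_mult_zero_sum[OF wg, of v] v(2) by (simp add: L_def)
    then have "inverse l *\<^sub>R (l *\<^sub>R v) \<in> zero_sum_vectors"
      by (rule zero_sum_scale)
    then have "m * (v \<bullet> v) \<le> l * (v \<bullet> v)"
      using rayleigh[of v] v l(1) by simp
    then show ?thesis
      using v(1) by simp
  qed
  ultimately have "min_nonzero_eigenvalue L = m"
    unfolding min_nonzero_eigenvalue_def using m_pos by (intro Least_equality) auto
  then show "0 < min_nonzero_eigenvalue (laplacian E k)"
    and "v \<in> zero_sum_vectors \<Longrightarrow> min_nonzero_eigenvalue (laplacian E k) * (v \<bullet> v) \<le> v \<bullet> (laplacian E k *v v)"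
    using m_pos rayleigh by (simp_all add: L_def)
qed

text \<open>The test vector is the unit vector at \<open>x\<close> projected onto the zero-sum
  vectors. Subtracting a constant leaves the form unchanged, and the squared norm is
  \<open>1 - 1 / n\<close>, at least 1/2 because \<open>n\<close> is at least 2. The bound serves to
  compare \<open>C\<close> with \<open>C'\<close>.\<close>

lemma min_nonzero_eigenvalue_le_diagonal:
  fixes k :: "'v::finite \<Rightarrow> 'v \<Rightarrow> real"
  assumes wg: "weighted_graph E k" and con: "graph_connected E"
  shows "min_nonzero_eigenvalue (laplacian E k) \<le> 2 * (axis x 1 \<bullet> (laplacian E k *v axis x 1))"
proof -
  let ?L = "laplacian E k" and ?n = "real CARD('v)"
  define c where "c = 1 / ?n"
  define u :: "real^'v" where "u = axis x 1 - c *\<^sub>R 1"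
  have n: "2 \<le> ?n"
  proof -
    obtain y where "y \<in> nbrs E x"
      using nbrs_nonempty[OF wg con] by blast
    then have "x \<noteq> y"
      using weighted_graph_irrefl[OF wg] by metis
    then have "card {x, y} = 2"
      by simp
    then show ?thesis
      using card_mono[of UNIV "{x, y}"] by simp
  qed
  have "u \<in> zero_sum_vectors"
    using n by (simp add: u_def c_def zero_sum_vectors_def sum_subtractf axis_def)
  then have "min_nonzero_eigenvalue ?L * (u \<bullet> u) \<le> u \<bullet> (?L *v u)"
    by (rule min_nonzero_eigenvalue_le[OF wg con])
  also have "u \<bullet> (?L *v u) = axis x 1 \<bullet> (?L *v axis x 1)"
    by (simp add: inner_laplacian_self[OF wg] u_def)
  finally have *: "min_nonzero_eigenvalue ?L * (u \<bullet> u) \<le> axis x 1 \<bullet> (?L *v axis x 1)" .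
  have "(1::real^'v) \<bullet> 1 = ?n" "axis x 1 \<bullet> (1::real^'v) = 1" "(1::real^'v) \<bullet> axis x 1 = 1"
    by (simp_all add: inner_axis inner_axis') (simp add: inner_vec_def)
  then have "u \<bullet> u = 1 - c"
    using n by (simp add: u_def inner_diff_left inner_diff_right c_def inner_axis_axis field_simps)
  moreover have "c \<le> 1 / 2"
    using n by (simp add: c_def field_simps)
  ultimately have "1 / 2 \<le> u \<bullet> u"
    by simp
  then have "min_nonzero_eigenvalue ?L * (1 / 2) \<le> min_nonzero_eigenvalue ?L * (u \<bullet> u)"
    using min_nonzero_eigenvalue_pos[OF wg con] by (intro mult_left_mono) auto
  with * show ?thesis by simp
qed

section \<open>The Moore-Penrose inverse of a Laplacian\<close>

lemma matrix_add_rdistrib: "(A + B) ** C = A ** C + B ** C"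
  for A B :: "real^'n^'m"
  by (simp add: matrix_matrix_mult_def vec_eq_iff sum.distrib distrib_right)

lemma matrix_diff_ldistrib: "A ** (B - C) = A ** B - A ** C"
  for A :: "real^'n^'m"
  by (simp add: matrix_matrix_mult_def vec_eq_iff sum_subtractf right_diff_distrib)

lemma matrix_diff_rdistrib: "(A - B) ** C = A ** C - B ** C"
  for A B :: "real^'n^'m"
  by (simp add: matrix_matrix_mult_def vec_eq_iff sum_subtractf left_diff_distrib)

text \<open>Transposing \<open>A ** X = (A ** Y) ** (A ** X)\<close> turns the right side into
  \<open>(A ** X) ** (A ** Y) = A ** Y\<close>; in the same way \<open>X ** A = Y ** A\<close>. Then
  \<open>X = X ** A ** X = Y ** A ** Y = Y\<close>.\<close>

lemma pinv_eqI:
  assumes "is_pinv A X"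
  shows "pinv A = X"
  unfolding pinv_def
proof (rule the_equality)
  show "is_pinv A X" by fact
  fix Y assume Y: "is_pinv A Y"
  have AX: "A ** X = A ** Y"
    using assms Y unfolding is_pinv_def
    by (metis matrix_mul_assoc matrix_transpose_mul)
  have XA: "X ** A = Y ** A"
    using assms Y unfolding is_pinv_def
    by (metis matrix_mul_assoc matrix_transpose_mul)
  show "Y = X"
    using assms Y AX XA unfolding is_pinv_def by (metis matrix_mul_assoc)
qed

text \<open>This is the orthogonal projection onto the constant vectors, the kernel of the Laplacian
  of a connected graph.\<close>

definition averaging_matrix :: "real^'v::finite^'v" where
  "averaging_matrix = (\<chi> x y. 1 / real CARD('v))"

lemma averaging_matrix_mult_component:
  "((averaging_matrix :: real^'v::finite^'v) *v v) $ x = (\<Sum>y\<in>UNIV. v $ y) / real CARD('v)"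
  by (simp add: averaging_matrix_def matrix_vector_mult_def sum_divide_distrib)

lemma averaging_matrix_zero_sum: "v \<in> zero_sum_vectors \<Longrightarrow> averaging_matrix *v v = 0"
  by (simp add: vec_eq_iff averaging_matrix_mult_component zero_sum_vectors_def)

text \<open>Summing the entries of an equation \<open>(L + J) v = 0\<close> shows that
  \<open>v\<close> is zero-sum. Then \<open>J v = 0\<close>, hence \<open>L v = 0\<close>, and
  positive definiteness on zero-sum vectors gives \<open>v = 0\<close>.\<close>

lemma laplacian_plus_averaging_invertible:
  fixes k :: "'v::finite \<Rightarrow> 'v \<Rightarrow> real"
  assumes wg: "weighted_graph E k" and con: "graph_connected E"
  shows "invertible (laplacian E k + averaging_matrix)"
proof -
  have "v = 0" if 0: "(laplacian E k + averaging_matrix) *v v = 0" for v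
  proof -
    have L1: "(\<Sum>x\<in>UNIV. (laplacian E k *v v) $ x) = 0"
      using laplacian_mult_zero_sum[OF wg] by (simp add: zero_sum_vectors_def)
    have "0 = (\<Sum>x\<in>UNIV. ((laplacian E k + averaging_matrix) *v v) $ x)"
      by (simp add: 0)
    also have "\<dots> = (\<Sum>y\<in>UNIV. v $ y)"
      using L1 by (simp add: matrix_vector_mult_add_rdistrib sum.distrib averaging_matrix_mult_component)
    finally have z: "v \<in> zero_sum_vectors"
      by (simp add: zero_sum_vectors_def)
    then have "laplacian E k *v v = 0"
      using 0 by (simp add: matrix_vector_mult_add_rdistrib averaging_matrix_zero_sum)
    then show ?thesis
      using laplacian_form_zero_iff[OF wg con z] by simp
  qed
  then show ?thesis
    by (simp add: invertible_left_inverse matrix_left_invertible_ker)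
qed

text \<open>A zero-sum right-hand side forces \<open>v\<close> to be zero-sum, so the averaging term
  drops out.\<close>

lemma laplacian_plus_averaging_solution:
  assumes wg: "weighted_graph E k" and h: "h \<in> zero_sum_vectors"
    and eq: "(laplacian E k + averaging_matrix) *v v = h"
  shows "laplacian E k *v v = h"
proof -
  have L1: "(\<Sum>x\<in>UNIV. (laplacian E k *v v) $ x) = 0"
    using laplacian_mult_zero_sum[OF wg] by (simp add: zero_sum_vectors_def)
  have "0 = (\<Sum>x\<in>UNIV. ((laplacian E k + averaging_matrix) *v v) $ x)"
    using h by (simp add: eq zero_sum_vectors_def)
  also have "\<dots> = (\<Sum>y\<in>UNIV. v $ y)"
    using L1 by (simp add: matrix_vector_mult_add_rdistrib sum.distrib averaging_matrix_mult_component)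
  finally have "v \<in> zero_sum_vectors"
    by (simp add: zero_sum_vectors_def)
  then show ?thesis
    using eq by (simp add: matrix_vector_mult_add_rdistrib averaging_matrix_zero_sum)
qed

text \<open>With \<open>J\<close> the averaging matrix, the pseudoinverse of \<open>L\<close> is \<open>(L + J)\<^sup>-\<^sup>1 - J\<close>.\<close>

lemma laplacian_pinv:
  fixes k :: "'v::finite \<Rightarrow> 'v \<Rightarrow> real"
  assumes wg: "weighted_graph E k" and con: "graph_connected E"
    and h: "h \<in> zero_sum_vectors"
  shows "laplacian E k *v (pinv (laplacian E k) *v h) = h"
    and "pinv (laplacian E k) *v h \<in> zero_sum_vectors"
proof -
  define L where "L = laplacian E k"
  define J where "J = (averaging_matrix :: real^'v^'v)"
  obtain B where B: "(L + J) ** B = mat 1" "B ** (L + J) = mat 1"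
    using laplacian_plus_averaging_invertible[OF wg con] by (auto simp: invertible_def L_def J_def)
  have sym: "transpose L = L" "transpose J = J"
    using weighted_graph_sym[OF wg]
    by (auto simp: L_def J_def laplacian_def degree_matrix_def adjacency_matrix_def
        averaging_matrix_def transpose_def vec_eq_iff insert_commute nbrs_def)
  have JL: "J ** L = 0"
  proof -
    have "J *v (L *v v) = 0" for v
      unfolding J_def L_def by (rule averaging_matrix_zero_sum[OF laplacian_mult_zero_sum[OF wg]])
    then show ?thesis
      by (simp add: matrix_eq matrix_vector_mul_assoc)
  qed
  have LJ: "L ** J = 0"
  proof -
    have "transpose (0 :: real^'v^'v) = 0"
      by (simp add: transpose_def vec_eq_iff)
    then show ?thesis
      using arg_cong[OF JL, of transpose] sym by (simp add: matrix_transpose_mul)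
  qed
  have JJ: "J ** J = J"
    by (simp add: J_def averaging_matrix_def matrix_matrix_mult_def)
  \<comment> \<open>Multiply \<open>(L + J) ** B = mat 1\<close> by \<open>J\<close> from the left;
    \<open>J ** L = 0\<close> and \<open>J ** J = J\<close> leave \<open>J ** B\<close>.\<close>
  have JB: "J ** B = J"
    using B(1) JL JJ 
    by (metis add.left_neutral matrix_add_ldistrib matrix_mul_assoc matrix_mul_rid)
  have BJ: "B ** J = J"
    using B(2) LJ JJ 
    by (metis add.left_neutral matrix_add_rdistrib matrix_mul_assoc matrix_mul_lid)
  define X where "X = B - J"
  \<comment> \<open>Both products of \<open>L\<close> and \<open>X\<close> are the orthogonal
    projection onto the zero-sum vectors. Its symmetry, together with \<open>J ** L = 0\<close> and
    \<open>J ** X = 0\<close>, yields the four Penrose identities.\<close>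
  have LX: "L ** X = mat 1 - J"
    using B(1) by (simp add: X_def matrix_diff_ldistrib matrix_add_rdistrib LJ JB algebra_simps)
  have XL: "X ** L = mat 1 - J"
    using B(2) by (simp add: X_def matrix_diff_rdistrib matrix_add_ldistrib JL BJ algebra_simps)
  have JX: "J ** X = 0"
    by (simp add: X_def matrix_diff_ldistrib JB JJ)
  have symX: "transpose (mat 1 - J) = mat 1 - J"
    using sym(2) by (simp add: transpose_def vec_eq_iff mat_def)
  have "is_pinv L X"
    by (simp add: is_pinv_def LX XL symX matrix_diff_rdistrib JL JX)
  then have pinv: "pinv (laplacian E k) = X"
    unfolding L_def by (rule pinv_eqI)
  have Jh: "J *v h = 0"
    using h by (simp add: J_def averaging_matrix_zero_sum)
  show "laplacian E k *v (pinv (laplacian E k) *v h) = h"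
    unfolding pinv using LX Jh
    by (simp add: matrix_vector_mul_assoc matrix_vector_mult_diff_rdistrib flip: L_def)
  have "J *v (X *v h) = 0"
    by (simp add: matrix_vector_mul_assoc JX)
  then show "pinv (laplacian E k) *v h \<in> zero_sum_vectors"
    unfolding pinv by (simp add: J_def vec_eq_iff averaging_matrix_mult_component zero_sum_vectors_def)
qed

text \<open>With \<open>\<phi> = pinv L *v h\<close> the form equals
  \<open>\<phi> \<bullet> (L *v \<phi>)\<close>. The upper bound combines the spectral gap at
  \<open>\<phi>\<close> with nonnegativity of the squared norm of
  \<open>h - m *\<^sub>R \<phi>\<close>.\<close>

lemma laplacian_pinv_form:
  fixes k :: "'v::finite \<Rightarrow> 'v \<Rightarrow> real"
  assumes wg: "weighted_graph E k" and con: "graph_connected E"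
    and h: "h \<in> zero_sum_vectors"
  shows "0 \<le> h \<bullet> (pinv (laplacian E k) *v h)"
    and "min_nonzero_eigenvalue (laplacian E k) * (h \<bullet> (pinv (laplacian E k) *v h)) \<le> h \<bullet> h"
proof -
  define \<phi> where "\<phi> = pinv (laplacian E k) *v h"
  define m where "m = min_nonzero_eigenvalue (laplacian E k)"
  have \<phi>: "laplacian E k *v \<phi> = h" "\<phi> \<in> zero_sum_vectors"
    using laplacian_pinv[OF assms] by (simp_all add: \<phi>_def)
  have "0 \<le> h \<bullet> \<phi>"
    using inner_laplacian_nonneg[OF wg, of \<phi>] \<phi>(1) by (simp add: inner_commute)
  then show "0 \<le> h \<bullet> (pinv (laplacian E k) *v h)"
    by (simp add: \<phi>_def)
  have "m * (\<phi> \<bullet> \<phi>) \<le> h \<bullet> \<phi>"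
    using min_nonzero_eigenvalue_le[OF wg con \<phi>(2)] \<phi>(1) by (simp add: m_def inner_commute)
  then have "m * (m * (\<phi> \<bullet> \<phi>)) \<le> m * (h \<bullet> \<phi>)"
    using min_nonzero_eigenvalue_pos[OF wg con] by (simp add: m_def mult_left_mono)
  moreover have "0 \<le> (h - m *\<^sub>R \<phi>) \<bullet> (h - m *\<^sub>R \<phi>)"
    by simp
  then have "2 * (m * (h \<bullet> \<phi>)) \<le> h \<bullet> h + m * (m * (\<phi> \<bullet> \<phi>))"
    by (simp add: inner_diff_left inner_diff_right inner_commute[of \<phi> h] algebra_simps)
  ultimately show "min_nonzero_eigenvalue (laplacian E k) * (h \<bullet> (pinv (laplacian E k) *v h)) \<le> h \<bullet> h"
    by (simp add: m_def \<phi>_def)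
qed

section \<open>Tilted weights and the action\<close>

lemma pos_densitiesD:
  assumes "\<rho> \<in> pos_densities"
  shows "0 < \<rho> $ x" and "(\<Sum>x\<in>UNIV. \<rho> $ x) = 1"
  using assms by (auto simp: pos_densities_def densities_def)

text \<open>Symmetry and positivity of the logarithmic mean carry over to the weights, which makes
  all facts about Laplacians available for tilted weights.\<close>

lemma weighted_graph_tilted:
  assumes "weighted_graph E w" "\<pi> \<in> pos_densities" "\<rho> \<in> pos_densities"
  shows "weighted_graph E (tilted_weights w \<pi> \<rho>)"
proof -
  have pos: "0 < \<rho> $ x / \<pi> $ x" for x
    by (simp add: pos_densitiesD(1)[OF assms(2)] pos_densitiesD(1)[OF assms(3)])
  have "tilted_weights w \<pi> \<rho> x y = tilted_weights w \<pi> \<rho> y x \<and> 0 < tilted_weights w \<pi> \<rho> x y"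
    if "{x, y} \<in> E" for x y
    using assms(1) that log_mean_pos[OF pos pos, of x y] log_mean_commute[OF pos pos, of x y]
    by (auto simp: weighted_graph_def tilted_weights_def)
  then show ?thesis
    using assms(1) unfolding weighted_graph_def by blast
qed

lemma tilted_weights_mono:
  assumes wg: "weighted_graph E w" and pos: "\<pi> \<in> pos_densities" "\<rho> \<in> pos_densities" "0 < c" "\<And>x. 0 < \<sigma> $ x"
    and le: "\<And>x. \<rho> $ x \<le> c * \<sigma> $ x" and "y \<in> nbrs E x"
  shows "tilted_weights w \<pi> \<rho> x y \<le> c * tilted_weights w \<pi> \<sigma> x y"
proof -
  have "log_mean (\<rho> $ x / \<pi> $ x) (\<rho> $ y / \<pi> $ y) \<le> log_mean (c * (\<sigma> $ x / \<pi> $ x)) (c * (\<sigma> $ y / \<pi> $ y))"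
    using le pos_densitiesD(1)[OF pos(1)] pos_densitiesD(1)[OF pos(2)]
    by (intro log_mean_mono) (simp_all add: divide_right_mono less_imp_le)
  also have "\<dots> = c * log_mean (\<sigma> $ x / \<pi> $ x) (\<sigma> $ y / \<pi> $ y)"
    using pos(3,4) pos_densitiesD(1)[OF pos(1)] by (intro log_mean_scale) simp_all
  finally show ?thesis
    using weighted_graph_pos[OF wg assms(7)] by (simp add: tilted_weights_def mult_left_mono)
qed

text \<open>Stationarity gives \<open>\<pi> = d / Vol\<close>. By the arithmetic mean bound, an edge
  \<open>{x, y}\<close> contributes at most \<open>Vol / 2\<close> times
  \<open>w x y * \<rho> x / d x + w x y * \<rho> y / d y\<close>, where
  \<open>w x y \<le> d y\<close>. Summed over the neighbours of \<open>x\<close>, the bracket is at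
  most the total mass 1.\<close>

lemma laplacian_tilted_diagonal_le:
  fixes \<pi> \<rho> :: "real^'v::finite"
  assumes wg: "weighted_graph E w" and con: "graph_connected E"
    and pi: "\<pi> \<in> pos_densities" "stationary_distribution E w \<pi>" and \<rho>: "\<rho> \<in> pos_densities"
  shows "axis x 1 \<bullet> (laplacian E (tilted_weights w \<pi> \<rho>) *v axis x 1) \<le> graph_vol E w / 2"
proof -
  let ?V = "graph_vol E w"
  have V: "0 < ?V" and d: "\<And>x. 0 < deg E w x"
    using graph_vol_pos[OF wg con] deg_pos[OF wg con] by auto
  have ratio: "\<rho> $ y / \<pi> $ y = ?V * \<rho> $ y / deg E w y" for y
    by (simp add: stationary_distribution_eq[OF wg con pi(2)])
  have edge: "tilted_weights w \<pi> \<rho> x y \<le> ?V / 2 * (w x y * \<rho> $ x / deg E w x + \<rho> $ y)"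
    if y: "y \<in> nbrs E x" for y
  proof -
    have wpos: "0 < w x y"
      by (rule weighted_graph_pos[OF wg y])
    have "w x y = w y x" "x \<in> nbrs E y"
      using weighted_graph_sym[OF wg y] y nbrs_commute by metis+
    then have wd: "w x y \<le> deg E w y"
      unfolding deg_def using member_le_sum[of x "nbrs E y" "w y"] weighted_graph_pos[OF wg]
      by (simp add: less_imp_le)
    have "tilted_weights w \<pi> \<rho> x y \<le> w x y * ((\<rho> $ x / \<pi> $ x + \<rho> $ y / \<pi> $ y) / 2)"
      unfolding tilted_weights_def using wpos pos_densitiesD(1)[OF pi(1)] pos_densitiesD(1)[OF \<rho>]
      by (intro mult_left_mono log_mean_le_arith_mean) (simp_all add: less_imp_le)
    also have "\<dots> = ?V / 2 * (w x y * \<rho> $ x / deg E w x + w x y / deg E w y * \<rho> $ y)"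
      unfolding ratio by (simp add: field_simps)
    also have "\<dots> \<le> ?V / 2 * (w x y * \<rho> $ x / deg E w x + 1 * \<rho> $ y)"
      using V wd d pos_densitiesD[OF \<rho>]
      by (intro mult_left_mono add_left_mono mult_right_mono) (auto simp: less_imp_le)
    finally show ?thesis by simp
  qed
  have "axis x 1 \<bullet> (laplacian E (tilted_weights w \<pi> \<rho>) *v axis x 1) = (\<Sum>y\<in>nbrs E x. tilted_weights w \<pi> \<rho> x y)"
    using weighted_graph_irrefl[OF wg, of x]
    unfolding inner_axis' laplacian_mult_component by (auto simp: axis_def intro!: sum.cong)
  also have "\<dots> \<le> (\<Sum>y\<in>nbrs E x. ?V / 2 * (w x y * \<rho> $ x / deg E w x + \<rho> $ y))"
    by (rule sum_mono) (rule edge)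
  also have "\<dots> = ?V / 2 * (deg E w x * \<rho> $ x / deg E w x + (\<Sum>y\<in>nbrs E x. \<rho> $ y))"
    by (simp add: deg_def sum.distrib sum_divide_distrib sum_distrib_right flip: sum_distrib_left)
  also have "\<dots> = ?V / 2 * (\<Sum>y\<in>insert x (nbrs E x). \<rho> $ y)"
    using weighted_graph_irrefl[OF wg, of x] less_imp_neq[OF d[of x]] by simp
  also have "\<dots> \<le> ?V / 2 * (\<Sum>y\<in>UNIV. \<rho> $ y)"
    using V pos_densitiesD(1)[OF \<rho>]
    by (intro mult_left_mono sum_mono2) (auto simp: less_imp_le)
  finally show ?thesis
    using pos_densitiesD(2)[OF \<rho>] by simp
qed

lemma action_density_eq:
  assumes "weighted_graph E (tilted_weights w \<pi> \<rho>)"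
  shows "action_density E w \<pi> \<rho> \<psi> = \<psi> \<bullet> (laplacian E (tilted_weights w \<pi> \<rho>) *v \<psi>)"
  unfolding inner_laplacian_self[OF assms] action_density_def
  by (simp add: tilted_weights_def mult_ac)

lemma continuity_equation_iff:
  "(\<forall>x. v $ x + (\<Sum>y\<in>nbrs E x. w x y * (\<psi> $ y - \<psi> $ x)
       * log_mean (\<rho> $ x / \<pi> $ x) (\<rho> $ y / \<pi> $ y)) = 0)
   \<longleftrightarrow> v = laplacian E (tilted_weights w \<pi> \<rho>) *v \<psi>"
proof -
  have "(\<Sum>y\<in>nbrs E x. w x y * (\<psi> $ y - \<psi> $ x) * log_mean (\<rho> $ x / \<pi> $ x) (\<rho> $ y / \<pi> $ y))
      = - ((laplacian E (tilted_weights w \<pi> \<rho>) *v \<psi>) $ x)" for x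
    unfolding laplacian_mult_component tilted_weights_def
    by (subst sum_negf[symmetric], intro sum.cong refl) (simp add: algebra_simps)
  then show ?thesis
    by (simp add: vec_eq_iff)
qed

lemma admissible_iff:
  "(\<rho>, \<psi>) \<in> admissible E w \<pi> \<mu> \<nu> \<longleftrightarrow>
     (\<forall>t\<in>{0..1}. \<rho> t \<in> pos_densities) \<and> \<rho> 0 = \<mu> \<and> \<rho> 1 = \<nu> \<and>
     \<psi> \<in> borel_measurable (restrict_space borel {0..1}) \<and>
     (\<exists>\<rho>'. continuous_on {0..1} \<rho>' \<and>
       (\<forall>t\<in>{0..1}. (\<rho> has_vector_derivative \<rho>' t) (at t within {0..1}) \<and>
         \<rho>' t = laplacian E (tilted_weights w \<pi> (\<rho> t)) *v \<psi> t))"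
  unfolding admissible_def by (simp add: continuity_equation_iff)

section \<open>Lower bounds for the action of a curve\<close>

lemma nn_integral_ge_integral:
  fixes f g :: "real \<Rightarrow> real"
  assumes "continuous_on {a..b} g" "\<And>t. t \<in> {a..b} \<Longrightarrow> g t \<le> f t" "{a..b} \<subseteq> S"
  shows "ennreal (integral {a..b} g) \<le> (\<integral>\<^sup>+t\<in>S. ennreal (f t) \<partial>lborel)"
proof -
  have int: "set_integrable lborel {a..b} g"
    by (rule borel_integrable_atLeastAtMost') fact
  have "ennreal (integral {a..b} g) = ennreal (LINT t|lborel. indicator {a..b} t * g t)"
    using set_borel_integral_eq_integral(2)[OF int] by (simp add: set_lebesgue_integral_def)
  \<comment> \<open>The minorant may be negative, so its positive part is taken before passing to
    the nonnegative integral.\<close>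
  also have "\<dots> \<le> ennreal (LINT t|lborel. max 0 (indicator {a..b} t * g t))"
    using int by (intro ennreal_leI integral_mono integrable_max) (auto simp: set_integrable_def)
  also have "\<dots> = (\<integral>\<^sup>+t. ennreal (max 0 (indicator {a..b} t * g t)) \<partial>lborel)"
    using int by (intro nn_integral_eq_integral[symmetric] integrable_max) (auto simp: set_integrable_def)
  also have "\<dots> \<le> (\<integral>\<^sup>+t\<in>S. ennreal (f t) \<partial>lborel)"
    using assms(2,3) by (intro nn_integral_mono) (auto simp: indicator_def max_def ennreal_leI)
  finally show ?thesis .
qed

text \<open>Young's inequality replaces Cauchy--Schwarz in time: integrate
  \<open>2 s \<phi> \<bullet> \<rho>' - s\<^sup>2 \<phi> \<bullet> L \<phi> \<le> \<psi> \<bullet> L \<psi>\<close> for constant \<open>s\<close> and optimize over \<open>s\<close>.\<close>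

lemma action_lower_bound:
  fixes \<mu> \<nu> \<pi> :: "real^'v::finite"
  assumes wg: "weighted_graph E w" and pi: "\<pi> \<in> pos_densities"
    and adm: "(\<rho>, \<psi>) \<in> admissible E w \<pi> \<mu> \<nu>"
    and T: "0 \<le> T" "T \<le> 1" and M: "0 < M"
    and bound: "\<And>t. t \<in> {0..T} \<Longrightarrow> \<phi> \<bullet> (laplacian E (tilted_weights w \<pi> (\<rho> t)) *v \<phi>) \<le> M"
  shows "ennreal ((\<phi> \<bullet> (\<rho> T - \<mu>))\<^sup>2 / M)
       \<le> (\<integral>\<^sup>+t\<in>{0..1}. ennreal (action_density E w \<pi> (\<rho> t) (\<psi> t)) \<partial>lborel)"
proof -
  obtain \<rho>' where \<rho>'_cont: "continuous_on {0..1} \<rho>'"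
    and deriv: "\<And>t. t \<in> {0..1} \<Longrightarrow> (\<rho> has_vector_derivative \<rho>' t) (at t within {0..1})"
    and \<rho>'_eq: "\<And>t. t \<in> {0..1} \<Longrightarrow> \<rho>' t = laplacian E (tilted_weights w \<pi> (\<rho> t)) *v \<psi> t"
    and pos: "\<And>t. t \<in> {0..1} \<Longrightarrow> \<rho> t \<in> pos_densities" and \<rho>0: "\<rho> 0 = \<mu>"
    using adm unfolding admissible_iff by blast
  have sub: "{0..T} \<subseteq> {0..1}"
    using T by auto
  define D where "D = \<phi> \<bullet> (\<rho> T - \<mu>)"
  \<comment> \<open>This is the maximizer of \<open>2 * s * D - s\<^sup>2 * M\<close>; the maximum
    is \<open>D\<^sup>2 / M\<close>.\<close>
  define s where "s = D / M"
  define g where "g t = 2 * s * (\<phi> \<bullet> \<rho>' t) - s\<^sup>2 * M" for t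
  have "(\<rho>' has_integral (\<rho> T - \<rho> 0)) {0..T}"
    using T sub by (intro fundamental_theorem_of_calculus)
      (auto intro: has_vector_derivative_within_subset[OF deriv])
  then have "((\<lambda>t. \<phi> \<bullet> \<rho>' t) has_integral D) {0..T}"
    unfolding D_def \<rho>0[symmetric]
    by (rule has_integral_linear[OF _ bounded_linear_inner_right, unfolded o_def])
  then have "(g has_integral (2 * s * D - T * (s\<^sup>2 * M))) {0..T}"
    unfolding g_def using T has_integral_const_real[of "s\<^sup>2 * M" 0 T]
    by (intro has_integral_diff has_integral_mult_right) auto
  then have ig: "integral {0..T} g = 2 * s * D - T * (s\<^sup>2 * M)"
    by (rule integral_unique)
  \<comment> \<open>Stopping at a time \<open>T\<close> before 1 only reduces the subtracted term,
    so the bound is uniform in \<open>T\<close>.\<close>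
  have "T * (s\<^sup>2 * M) \<le> 1 * (s\<^sup>2 * M)"
    using T M by (intro mult_right_mono) auto
  moreover have "2 * s * D - s\<^sup>2 * M = D\<^sup>2 / M"
    using M by (simp add: s_def power2_eq_square)
  ultimately have "D\<^sup>2 / M \<le> integral {0..T} g"
    unfolding ig by simp
  moreover have "continuous_on {0..T} g"
    unfolding g_def using continuous_on_subset[OF \<rho>'_cont sub] by (intro continuous_intros)
  moreover have "g t \<le> action_density E w \<pi> (\<rho> t) (\<psi> t)" if t: "t \<in> {0..T}" for t
  proof -
    have t1: "t \<in> {0..1}"
      using t sub by blast
    have wgt: "weighted_graph E (tilted_weights w \<pi> (\<rho> t))"
      by (rule weighted_graph_tilted[OF wg pi pos[OF t1]])
    have "s\<^sup>2 * (\<phi> \<bullet> (laplacian E (tilted_weights w \<pi> (\<rho> t)) *v \<phi>)) \<le> s\<^sup>2 * M"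
      using bound[OF t] by (rule mult_left_mono) simp
    then show ?thesis
      using inner_laplacian_Young[OF wgt, of s \<phi> "\<psi> t"]
      by (simp add: g_def \<rho>'_eq[OF t1] action_density_eq[OF wgt])
  qed
  ultimately show ?thesis
    unfolding D_def[symmetric] using sub
    by (intro order_trans[OF ennreal_leI nn_integral_ge_integral]) auto
qed

section \<open>Bounds on the transportation distance\<close>

lemma pinv_form_le_inverse_eigenvalue:
  fixes k :: "'v::finite \<Rightarrow> 'v \<Rightarrow> real"
  assumes wg: "weighted_graph E k" and con: "graph_connected E"
    and h: "h \<in> zero_sum_vectors" "norm h \<le> 1"
  shows "h \<bullet> (pinv (laplacian E k) *v h) \<le> 1 / min_nonzero_eigenvalue (laplacian E k)"
proof -
  have "h \<bullet> h \<le> 1"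
    using h(2) by (simp add: dot_square_norm power_le_one)
  then show ?thesis
    using laplacian_pinv_form(2)[OF wg con h(1)] min_nonzero_eigenvalue_pos[OF wg con]
    by (simp add: field_simps)
qed

text \<open>Either the curve stays below \<open>(1 + C' \<bar>\<epsilon>\<bar>) \<mu>\<close>, where its Laplacians are dominated by
  \<open>(1 + C' \<bar>\<epsilon>\<bar>) L\<close>, or the mass at some vertex grows so much that this alone costs at least
  \<open>4 \<epsilon>\<^sup>2 / \<lambda>\<^sub>2\<close>.\<close>

lemma transport_cost_lower_bound:
  fixes \<pi> \<mu> :: "real^'v::finite"
  assumes wg: "weighted_graph E w" and con: "graph_connected E"
    and pi: "\<pi> \<in> pos_densities" "stationary_distribution E w \<pi>" and mu: "\<mu> \<in> pos_densities"
    and L: "L = laplacian E (tilted_weights w \<pi> \<mu>)"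
    and C: "\<And>x. 1 \<le> C * \<mu> $ x"
    and C': "C' = C * sqrt (2 * graph_vol E w / min_nonzero_eigenvalue L)" "0 \<le> C'"
    and h: "h \<in> zero_sum_vectors" "norm h \<le> 1"
  shows "ennreal (\<epsilon>\<^sup>2 / (1 + C' * \<bar>\<epsilon>\<bar>) * (h \<bullet> (pinv L *v h)))
       \<le> transport_cost E w \<pi> \<mu> (\<mu> + \<epsilon> *\<^sub>R h)"
proof -
  define c where "c = 1 + C' * \<bar>\<epsilon>\<bar>"
  define Q where "Q = h \<bullet> (pinv L *v h)"
  define m where "m = min_nonzero_eigenvalue L"
  define V where "V = graph_vol E w"
  have wg\<mu>: "weighted_graph E (tilted_weights w \<pi> \<mu>)"
    by (rule weighted_graph_tilted[OF wg pi(1) mu])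
  have V: "0 < V"
    unfolding V_def by (rule graph_vol_pos[OF wg con])
  have m: "0 < m"
    unfolding m_def L by (rule min_nonzero_eigenvalue_pos[OF wg\<mu> con])
  have c: "1 \<le> c"
    using C'(2) by (simp add: c_def)
  have Q: "0 \<le> Q" "Q \<le> 1 / m"
    unfolding Q_def m_def L
    by (rule laplacian_pinv_form[OF wg\<mu> con h(1)], rule pinv_form_le_inverse_eigenvalue[OF wg\<mu> con h])
  have "ennreal (\<epsilon>\<^sup>2 / c * Q) \<le> (\<integral>\<^sup>+t\<in>{0..1}. ennreal (action_density E w \<pi> (\<rho> t) (\<psi> t)) \<partial>lborel)"
    (is "_ \<le> ?A")
    if adm: "(\<rho>, \<psi>) \<in> admissible E w \<pi> \<mu> (\<mu> + \<epsilon> *\<^sub>R h)" for \<rho> \<psi>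
  proof -
    have pos: "\<rho> t \<in> pos_densities" if "t \<in> {0..1}" for t
      using adm that unfolding admissible_iff by blast
    have \<rho>1: "\<rho> 1 = \<mu> + \<epsilon> *\<^sub>R h"
      using adm unfolding admissible_iff by blast
    show ?thesis
    proof (cases "\<forall>t\<in>{0..1}. \<forall>x. \<rho> t $ x \<le> c * \<mu> $ x")
      case True
      show ?thesis
      \<comment> \<open>For \<open>Q = 0\<close> the left side vanishes; otherwise
        \<open>M = c * Q\<close> is a positive bound for the form at \<open>\<phi>\<close>, and the
        whole curve is used, with \<open>T = 1\<close>.\<close>
      proof (cases "Q = 0")
        case False
        define \<phi> where "\<phi> = pinv L *v h"
        have L\<phi>: "L *v \<phi> = h"
          unfolding L \<phi>_def by (rule laplacian_pinv(1)[OF wg\<mu> con h(1)])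
        have "\<phi> \<bullet> (laplacian E (tilted_weights w \<pi> (\<rho> t)) *v \<phi>) \<le> c * Q" if t: "t \<in> {0..1}" for t
        proof -
          have "\<phi> \<bullet> (laplacian E (tilted_weights w \<pi> (\<rho> t)) *v \<phi>) \<le> c * (\<phi> \<bullet> (L *v \<phi>))"
            unfolding L using True t c wg pos_densitiesD(1)[OF mu]
            by (intro inner_laplacian_mono weighted_graph_tilted wg pi mu pos tilted_weights_mono) auto
          then show ?thesis
            by (simp add: L\<phi>) (simp add: Q_def \<phi>_def inner_commute)
        qed
        from action_lower_bound[OF wg pi(1) adm _ _ _ this, of 1]
        have "ennreal ((\<phi> \<bullet> (\<rho> 1 - \<mu>))\<^sup>2 / (c * Q)) \<le> ?A"
          using c Q(1) False by simp
        moreover have "(\<phi> \<bullet> (\<rho> 1 - \<mu>))\<^sup>2 / (c * Q) = \<epsilon>\<^sup>2 / c * Q"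
        proof -
          have "\<phi> \<bullet> (\<rho> 1 - \<mu>) = \<epsilon> * Q"
            by (simp add: \<rho>1 Q_def \<phi>_def inner_commute)
          then show ?thesis
            using False by (simp add: power_mult_distrib power2_eq_square)
        qed
        ultimately show ?thesis by simp
      qed simp
    next
      case False
      then obtain t x where t: "t \<in> {0..1}" and less: "c * \<mu> $ x < \<rho> t $ x"
        by (auto simp: not_le)
      \<comment> \<open>The action bound is applied up to the time \<open>t\<close> of the
        violation, with the unit vector at the offending vertex as potential.\<close>
      have "ennreal ((axis x 1 \<bullet> (\<rho> t - \<mu>))\<^sup>2 / (V / 2)) \<le> ?A"
        using t V unfolding V_def
        by (intro action_lower_bound[OF wg pi(1) adm] laplacian_tilted_diagonal_le[OF wg con pi] pos) auto
      moreover have "\<epsilon>\<^sup>2 / c * Q \<le> (axis x 1 \<bullet> (\<rho> t - \<mu>))\<^sup>2 / (V / 2)"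
      proof -
        \<comment> \<open>Since \<open>C' = C * ?r\<close> and \<open>C * \<mu> $ x\<close> is at
          least 1, the mass gained at \<open>x\<close> is at least
          \<open>?r * \<bar>\<epsilon>\<bar>\<close>. Its square divided by \<open>V / 2\<close> is
          at least \<open>4 * \<epsilon>\<^sup>2 / m\<close>, while the required bound is at most
          \<open>\<epsilon>\<^sup>2 / m\<close>.\<close>
        let ?r = "sqrt (2 * V / m)"
        have "1 * ?r \<le> (C * \<mu> $ x) * ?r"
          using C[of x] V m by (intro mult_right_mono) auto
        then have "?r \<le> C' * \<mu> $ x"
          by (simp add: C'(1) V_def m_def mult_ac)
        then have "?r * \<bar>\<epsilon>\<bar> \<le> (C' * \<mu> $ x) * \<bar>\<epsilon>\<bar>"
          by (rule mult_right_mono) simp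
        also have "\<dots> = c * \<mu> $ x - \<mu> $ x"
          by (simp add: c_def algebra_simps)
        also have "\<dots> \<le> axis x 1 \<bullet> (\<rho> t - \<mu>)"
          using less by (simp add: inner_axis')
        finally have "(?r * \<bar>\<epsilon>\<bar>)\<^sup>2 \<le> (axis x 1 \<bullet> (\<rho> t - \<mu>))\<^sup>2"
          using V m by (intro power_mono) auto
        then have "2 * V / m * \<epsilon>\<^sup>2 / (V / 2) \<le> (axis x 1 \<bullet> (\<rho> t - \<mu>))\<^sup>2 / (V / 2)"
          using V m by (intro divide_right_mono) (simp_all add: power_mult_distrib)
        moreover have "2 * V / m * \<epsilon>\<^sup>2 / (V / 2) = 4 * (\<epsilon>\<^sup>2 * (1 / m))"
          using V by (simp add: field_simps)
        moreover have "\<epsilon>\<^sup>2 / c * Q \<le> \<epsilon>\<^sup>2 * (1 / m)"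
          using c Q by (intro mult_mono) (auto simp: divide_le_eq mult_le_cancel_left1 mult_left_le)
        moreover have "0 \<le> \<epsilon>\<^sup>2 * (1 / m)"
          using m by simp
        ultimately show ?thesis by linarith
      qed
      ultimately show ?thesis
        using ennreal_leI order_trans by blast
    qed
  qed
  then show ?thesis
    unfolding transport_cost_def c_def Q_def by (intro INF_greatest) auto
qed

section \<open>The upper bound along the straight line\<close>

text \<open>Cramer's rule for the invertible matrix \<open>L + J\<close> expresses the solution
  through determinants, which are polynomials in the entries and therefore continuous. Continuity
  supplies the Borel measurability of the potential demanded by admissibility.\<close>

lemma laplacian_continuous_solution:
  fixes k :: "'t::topological_space \<Rightarrow> 'v::finite \<Rightarrow> 'v \<Rightarrow> real"
  assumes wg: "\<And>t. t \<in> S \<Longrightarrow> weighted_graph E (k t)" and con: "graph_connected E"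
    and cont: "\<And>x y. y \<in> nbrs E x \<Longrightarrow> continuous_on S (\<lambda>t. k t x y)"
    and h: "h \<in> zero_sum_vectors"
  obtains \<psi> where "continuous_on S \<psi>" "\<And>t. t \<in> S \<Longrightarrow> laplacian E (k t) *v \<psi> t = h"
proof -
  define A where "A t = laplacian E (k t) + averaging_matrix" for t
  define \<psi> where "\<psi> t = (\<chi> j. det (\<chi> i l. if l = j then h $ i else A t $ i $ l) / det (A t))" for t
  have A_cont: "continuous_on S (\<lambda>t. A t $ i $ j)" for i j
  proof -
    have "continuous_on S (\<lambda>t. if {i, j} \<in> E then k t i j else 0)"
      using cont[of j i] by (cases "{i, j} \<in> E") (auto simp: nbrs_def)
    moreover have "continuous_on S (\<lambda>t. if i = j then deg E (k t) i else 0)"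
      unfolding deg_def by (cases "i = j") (auto intro!: continuous_on_sum cont)
    ultimately show ?thesis
      unfolding A_def laplacian_def degree_matrix_def adjacency_matrix_def
      by (simp add: continuous_on_diff continuous_on_add)
  qed
  have det: "det (A t) \<noteq> 0" if "t \<in> S" for t
    using laplacian_plus_averaging_invertible[OF wg[OF that] con]
    by (simp add: A_def invertible_det_nz)
  have "continuous_on S \<psi>"
  proof -
    have "continuous_on S (\<lambda>t. if l = j then h $ i else A t $ i $ l)" for i j l
      using A_cont by (cases "l = j") auto
    then show ?thesis
      unfolding \<psi>_def using det A_cont
      by (intro continuous_on_vec_lambda continuous_on_divide)
        (auto simp: det_def intro!: continuous_on_sum continuous_on_mult continuous_on_prod)
  qed
  moreover have "laplacian E (k t) *v \<psi> t = h" if t: "t \<in> S" for t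
    using laplacian_plus_averaging_solution[OF wg[OF t] h] cramer[OF det[OF t]]
    by (auto simp: A_def \<psi>_def)
  ultimately show ?thesis
    by (rule that)
qed

text \<open>Bounds the action of the straight line from \<open>\<mu>\<close> to \<open>\<mu> + \<epsilon> h\<close>.\<close>

lemma transport_cost_upper_bound:
  fixes \<pi> \<mu> :: "real^'v::finite"
  assumes wg: "weighted_graph E w" and con: "graph_connected E"
    and pi: "\<pi> \<in> pos_densities" and mu: "\<mu> \<in> pos_densities"
    and L: "L = laplacian E (tilted_weights w \<pi> \<mu>)"
    and C: "\<And>x. 1 \<le> C * \<mu> $ x" and \<epsilon>: "C * \<bar>\<epsilon>\<bar> < 1"
    and h: "h \<in> zero_sum_vectors" "norm h \<le> 1"
  shows "transport_cost E w \<pi> \<mu> (\<mu> + \<epsilon> *\<^sub>R h)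
       \<le> ennreal (\<epsilon>\<^sup>2 / (1 - C * \<bar>\<epsilon>\<bar>) * (h \<bullet> (pinv L *v h)))"
proof -
  define c where "c = 1 - C * \<bar>\<epsilon>\<bar>"
  define Q where "Q = h \<bullet> (pinv L *v h)"
  define \<rho> where "\<rho> t = \<mu> + (t * \<epsilon>) *\<^sub>R h" for t
  have c: "0 < c"
    using \<epsilon> by (simp add: c_def)
  have \<mu>: "0 < \<mu> $ x" for x
    by (rule pos_densitiesD(1)[OF mu])
  have wg\<mu>: "weighted_graph E (tilted_weights w \<pi> \<mu>)"
    by (rule weighted_graph_tilted[OF wg pi mu])
  \<comment> \<open>Each entry of \<open>h\<close> is at most 1 in absolute value, hence at most
    \<open>C * \<mu> $ x\<close>, so the perturbation costs at most the fraction
    \<open>C * \<bar>\<epsilon>\<bar>\<close> of \<open>\<mu> $ x\<close>.\<close>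
  have ge: "c * \<mu> $ x \<le> \<rho> t $ x" if t: "t \<in> {0..1}" for t x
  proof -
    have "\<bar>h $ x\<bar> \<le> 1"
      using component_le_norm_cart[of h x] h(2) by simp
    then have "\<bar>t * \<epsilon> * h $ x\<bar> \<le> 1 * \<bar>\<epsilon>\<bar> * 1"
      unfolding abs_mult using t by (intro mult_mono) auto
    also have "\<dots> \<le> (C * \<mu> $ x) * \<bar>\<epsilon>\<bar>"
      using mult_right_mono[OF C[of x], of "\<bar>\<epsilon>\<bar>"] by simp
    finally show ?thesis
      by (simp add: \<rho>_def c_def algebra_simps abs_le_iff)
  qed
  have \<rho>_pos: "\<rho> t \<in> pos_densities" if t: "t \<in> {0..1}" for t
  proof -
    have "0 < \<rho> t $ x" for x
      using ge[OF t, of x] mult_pos_pos[OF c \<mu>[of x]] by linarith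
    moreover have "(\<Sum>x\<in>UNIV. \<rho> t $ x) = 1"
      using pos_densitiesD(2)[OF mu] h(1)
      by (simp add: \<rho>_def sum.distrib zero_sum_vectors_def flip: sum_distrib_left)
    ultimately show ?thesis
      by (simp add: pos_densities_def densities_def less_imp_le)
  qed
  have wg\<rho>: "weighted_graph E (tilted_weights w \<pi> (\<rho> t))" if "t \<in> {0..1}" for t
    by (rule weighted_graph_tilted[OF wg pi \<rho>_pos[OF that]])
  obtain \<psi> where \<psi>: "continuous_on {0..1} \<psi>"
      "\<And>t. t \<in> {0..1} \<Longrightarrow> laplacian E (tilted_weights w \<pi> (\<rho> t)) *v \<psi> t = \<epsilon> *\<^sub>R h"
  proof (rule laplacian_continuous_solution[of "{0..1}" E "\<lambda>t. tilted_weights w \<pi> (\<rho> t)" "\<epsilon> *\<^sub>R h"])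
    fix x y
    show "continuous_on {0..1} (\<lambda>t. tilted_weights w \<pi> (\<rho> t) x y)"
      unfolding tilted_weights_def using pos_densitiesD(1)[OF pi] pos_densitiesD(1)[OF \<rho>_pos]
      by (intro continuous_on_mult continuous_on_const continuous_on_log_mean)
        (auto simp: \<rho>_def less_imp_neq[symmetric] intro!: continuous_intros)
  qed (use wg\<rho> con h(1) zero_sum_scale in auto)
  have "(\<rho>, \<psi>) \<in> admissible E w \<pi> \<mu> (\<mu> + \<epsilon> *\<^sub>R h)"
    unfolding admissible_iff
  proof (intro conjI exI[of _ "\<lambda>_. \<epsilon> *\<^sub>R h"] ballI)
    fix t :: real
    show "(\<rho> has_vector_derivative \<epsilon> *\<^sub>R h) (at t within {0..1})"
      unfolding \<rho>_def scaleR_scaleR[symmetric] by (auto intro!: derivative_eq_intros)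
  qed (use \<rho>_pos \<psi> in \<open>auto simp: \<rho>_def borel_measurable_continuous_on_restrict\<close>)
  then have "transport_cost E w \<pi> \<mu> (\<mu> + \<epsilon> *\<^sub>R h)
      \<le> (\<integral>\<^sup>+t\<in>{0..1}. ennreal (action_density E w \<pi> (\<rho> t) (\<psi> t)) \<partial>lborel)"
    unfolding transport_cost_def by (rule INF_lower2) simp
  also have "\<dots> \<le> (\<integral>\<^sup>+(t::real)\<in>{0..1}. ennreal (\<epsilon>\<^sup>2 / c * Q) \<partial>lborel)"
  proof -
    have "action_density E w \<pi> (\<rho> t) (\<psi> t) \<le> \<epsilon>\<^sup>2 / c * Q" if t: "t \<in> {0..1}" for t
    proof -
      define a where "a = \<psi> t \<bullet> (laplacian E (tilted_weights w \<pi> (\<rho> t)) *v \<psi> t)"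
      define \<phi> where "\<phi> = pinv L *v h"
      have L\<phi>: "L *v \<phi> = h"
        unfolding L \<phi>_def by (rule laplacian_pinv(1)[OF wg\<mu> con h(1)])
      \<comment> \<open>The lower bound on the curve reads
        \<open>\<mu> \<le> (1 / c) \<rho>\<close>, so the form of \<open>L\<close> is dominated by
        \<open>1 / c\<close> times that of the Laplacian at time \<open>t\<close>.\<close>
      have "\<psi> t \<bullet> (L *v \<psi> t) \<le> 1 / c * a"
        unfolding a_def L using c \<mu> ge[OF t] pos_densitiesD(1)[OF \<rho>_pos[OF t]]
        by (intro inner_laplacian_mono wg\<mu> wg\<rho>[OF t] tilted_weights_mono[OF wg pi mu]) (auto simp: field_simps)
      then have "c * (\<psi> t \<bullet> (L *v \<psi> t)) \<le> a"
        using c by (simp add: field_simps)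
      \<comment> \<open>Order reversal under inversion, by Young's inequality with
        \<open>s = \<epsilon> / c\<close>. After multiplication by \<open>c\<close> the left side is
        \<open>2 * a\<close>, because \<open>\<epsilon> * (\<phi> \<bullet> (L *v \<psi> t)) =
        \<epsilon> * (h \<bullet> \<psi> t) = a\<close>, and the last term is at most
        \<open>a\<close>; hence \<open>a \<le> \<epsilon>\<^sup>2 / c * Q\<close>.\<close>
      moreover have "2 * (\<epsilon> / c * (\<phi> \<bullet> (L *v \<psi> t))) \<le> (\<epsilon> / c)\<^sup>2 * (\<phi> \<bullet> (L *v \<phi>)) + \<psi> t \<bullet> (L *v \<psi> t)"
        unfolding L by (rule inner_laplacian_Young[OF wg\<mu>])
      then have "c * (2 * (\<epsilon> / c * (\<phi> \<bullet> (L *v \<psi> t)))) \<le> c * ((\<epsilon> / c)\<^sup>2 * (\<phi> \<bullet> (L *v \<phi>)) + \<psi> t \<bullet> (L *v \<psi> t))"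
        using c by (intro mult_left_mono) auto
      then have "2 * (\<epsilon> * (\<phi> \<bullet> (L *v \<psi> t))) \<le> \<epsilon>\<^sup>2 / c * (\<phi> \<bullet> (L *v \<phi>)) + c * (\<psi> t \<bullet> (L *v \<psi> t))"
        using c by (simp add: distrib_left power2_eq_square)
      moreover have "\<epsilon> * (\<phi> \<bullet> (L *v \<psi> t)) = a"
        using inner_laplacian_commute[OF wg\<mu>, of \<phi> "\<psi> t"] L\<phi> by (simp add: a_def \<psi>(2)[OF t] flip: L)
      moreover have "\<phi> \<bullet> (L *v \<phi>) = Q"
        unfolding L\<phi> by (simp add: Q_def \<phi>_def inner_commute)
      ultimately show ?thesis
        unfolding action_density_eq[OF wg\<rho>[OF t]] a_def[symmetric] by simp
    qed
    then show ?thesis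
      by (intro nn_integral_mono) (auto simp: indicator_def ennreal_leI)
  qed
  also have "\<dots> = ennreal (\<epsilon>\<^sup>2 / c * Q)"
    by (simp add: nn_integral_cmult_indicator)
  finally show ?thesis
    by (simp add: c_def Q_def)
qed

section \<open>The asymptotic expansion and the conclusion\<close>

text \<open>After division by \<open>\<epsilon>\<^sup>2\<close> the error lies between
  \<open>Q / (1 + C' * \<bar>\<epsilon>\<bar>) - Q\<close> and
  \<open>Q / (1 - C * \<bar>\<epsilon>\<bar>) - Q\<close>, which both tend to 0.\<close>

lemma smallo_square_of_two_sided_bound:
  fixes f :: "real \<Rightarrow> real"
  assumes "0 < \<delta>" "0 \<le> C" "0 \<le> C'" "0 \<le> Q"
    and bounds: "\<And>\<epsilon>. \<bar>\<epsilon>\<bar> < \<delta> \<Longrightarrow> \<epsilon>\<^sup>2 / (1 + C' * \<bar>\<epsilon>\<bar>) * Q \<le> f \<epsilon> \<and> f \<epsilon> \<le> \<epsilon>\<^sup>2 / (1 - C * \<bar>\<epsilon>\<bar>) * Q"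
  shows "(\<lambda>\<epsilon>. f \<epsilon> - \<bar>\<epsilon>\<bar>\<^sup>2 * Q) \<in> o[at 0](\<lambda>\<epsilon>. \<bar>\<epsilon>\<bar>\<^sup>2)"
proof (rule smalloI_tendsto)
  let ?l = "\<lambda>\<epsilon>::real. Q / (1 + C' * \<bar>\<epsilon>\<bar>) - Q" and ?u = "\<lambda>\<epsilon>::real. Q / (1 - C * \<bar>\<epsilon>\<bar>) - Q"
  have near: "\<forall>\<^sub>F \<epsilon> in at 0. \<epsilon> \<noteq> 0 \<and> \<bar>\<epsilon>\<bar> < \<delta>"
    using assms(1) by (auto simp: eventually_at intro!: exI[of _ \<delta>])
  show "((\<lambda>\<epsilon>. (f \<epsilon> - \<bar>\<epsilon>\<bar>\<^sup>2 * Q) / \<bar>\<epsilon>\<bar>\<^sup>2) \<longlongrightarrow> 0) (at 0)"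
  proof (rule tendsto_sandwich)
    show "(?l \<longlongrightarrow> 0) (at 0)" "(?u \<longlongrightarrow> 0) (at 0)"
      by (auto intro!: tendsto_eq_intros)
    show "\<forall>\<^sub>F \<epsilon> in at 0. ?l \<epsilon> \<le> (f \<epsilon> - \<bar>\<epsilon>\<bar>\<^sup>2 * Q) / \<bar>\<epsilon>\<bar>\<^sup>2"
      using near
    proof eventually_elim
      case (elim \<epsilon>)
      then have "\<epsilon>\<^sup>2 / (1 + C' * \<bar>\<epsilon>\<bar>) * Q / \<epsilon>\<^sup>2 \<le> f \<epsilon> / \<epsilon>\<^sup>2"
        using bounds by (intro divide_right_mono) auto
      then show ?case
        using elim by (simp add: diff_divide_distrib)
    qed
    show "\<forall>\<^sub>F \<epsilon> in at 0. (f \<epsilon> - \<bar>\<epsilon>\<bar>\<^sup>2 * Q) / \<bar>\<epsilon>\<bar>\<^sup>2 \<le> ?u \<epsilon>"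
      using near
    proof eventually_elim
      case (elim \<epsilon>)
      then have "f \<epsilon> / \<epsilon>\<^sup>2 \<le> \<epsilon>\<^sup>2 / (1 - C * \<bar>\<epsilon>\<bar>) * Q / \<epsilon>\<^sup>2"
        using bounds by (intro divide_right_mono) auto
      then show ?case
        using elim by (simp add: diff_divide_distrib)
    qed
  qed
  show "\<forall>\<^sub>F \<epsilon> in at 0. \<bar>\<epsilon>\<bar>\<^sup>2 \<noteq> (0::real)"
    using near by eventually_elim simp
qed

theorem theorem2p1:
  fixes E :: "'v::finite set set" and w :: "'v \<Rightarrow> 'v \<Rightarrow> real" and \<pi> \<mu> :: "real^'v"
    and L :: "real^'v^'v" and C C' :: real
  assumes graph: "weighted_graph E w" and connected: "graph_connected E"
    and pi: "\<pi> \<in> pos_densities" "stationary_distribution E w \<pi>"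
    and mu: "\<mu> \<in> pos_densities"
    and L: "L = laplacian E (tilted_weights w \<pi> \<mu>)"
    and C: "C = inverse (Min (range (\<lambda>x. \<mu> $ x)))"
    and C': "C' = C * sqrt (2 * graph_vol E w / min_nonzero_eigenvalue L)"
  shows "0 < C \<and> C \<le> C' \<and>
    (\<exists>\<delta>>0. \<forall>h\<in>zero_sum_vectors. norm h \<le> 1 \<longrightarrow> (\<forall>\<epsilon>. \<bar>\<epsilon>\<bar> < \<delta> \<longrightarrow>
       ennreal (\<epsilon>\<^sup>2 / (1 + C' * \<bar>\<epsilon>\<bar>) * (h \<bullet> (pinv L *v h)))
         \<le> (transport_dist E w \<pi> \<mu> (\<mu> + \<epsilon> *\<^sub>R h))\<^sup>2 \<and>
       (transport_dist E w \<pi> \<mu> (\<mu> + \<epsilon> *\<^sub>R h))\<^sup>2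
         \<le> ennreal (\<epsilon>\<^sup>2 / (1 - C * \<bar>\<epsilon>\<bar>) * (h \<bullet> (pinv L *v h))))) \<and>
    (\<forall>h\<in>zero_sum_vectors. norm h \<le> 1 \<longrightarrow>
       (\<lambda>\<epsilon>. enn2real ((transport_dist E w \<pi> \<mu> (\<mu> + \<epsilon> *\<^sub>R h))\<^sup>2)
             - \<bar>\<epsilon>\<bar>\<^sup>2 * (h \<bullet> (pinv L *v h)))
         \<in> o[at 0](\<lambda>\<epsilon>. \<bar>\<epsilon>\<bar>\<^sup>2))"
proof -
  have \<mu>: "0 < \<mu> $ x" for x
    by (rule pos_densitiesD(1)[OF mu])
  have wg\<mu>: "weighted_graph E (tilted_weights w \<pi> \<mu>)"
    by (rule weighted_graph_tilted[OF graph pi(1) mu])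
  have Min_pos: "0 < Min (range (\<lambda>x. \<mu> $ x))"
    using \<mu> by (simp add: Min_gr_iff)
  then have C_pos: "0 < C"
    by (simp add: C)
  have C\<mu>: "1 \<le> C * \<mu> $ x" for x
    using Min_pos Min_le[of "range (\<lambda>x. \<mu> $ x)" "\<mu> $ x"] by (simp add: C field_simps)
  have m_pos: "0 < min_nonzero_eigenvalue L"
    unfolding L by (rule min_nonzero_eigenvalue_pos[OF wg\<mu> connected])
  \<comment> \<open>The eigenvalue is at most twice a diagonal entry, and diagonal entries are at
    most \<open>Vol / 2\<close>; \<open>undefined\<close> stands for an arbitrary vertex. Hence the
    square root in \<open>C'\<close> is at least 1.\<close>
  have "min_nonzero_eigenvalue L \<le> graph_vol E w"
    using min_nonzero_eigenvalue_le_diagonal[OF wg\<mu> connected, of undefined]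
      laplacian_tilted_diagonal_le[OF graph connected pi mu, of undefined] by (simp add: L)
  then have "1 \<le> 2 * graph_vol E w / min_nonzero_eigenvalue L"
    using m_pos by (simp add: field_simps)
  then have CC': "C \<le> C'"
    using C_pos by (simp add: C')
  \<comment> \<open>The radius \<open>1 / C\<close> is where
    \<open>1 - C * \<bar>\<epsilon>\<bar>\<close> reaches 0; it depends on \<open>\<mu>\<close> only
    and serves every \<open>h\<close>.\<close>
  have bounds: "ennreal (\<epsilon>\<^sup>2 / (1 + C' * \<bar>\<epsilon>\<bar>) * (h \<bullet> (pinv L *v h)))
         \<le> (transport_dist E w \<pi> \<mu> (\<mu> + \<epsilon> *\<^sub>R h))\<^sup>2"
       "(transport_dist E w \<pi> \<mu> (\<mu> + \<epsilon> *\<^sub>R h))\<^sup>2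
         \<le> ennreal (\<epsilon>\<^sup>2 / (1 - C * \<bar>\<epsilon>\<bar>) * (h \<bullet> (pinv L *v h)))"
    if "h \<in> zero_sum_vectors" "norm h \<le> 1" "\<bar>\<epsilon>\<bar> < 1 / C" for h \<epsilon>
    unfolding transport_dist_square
    using that C_pos CC' C\<mu>
    by (intro transport_cost_lower_bound[OF graph connected pi mu L _ C']
        transport_cost_upper_bound[OF graph connected pi(1) mu L]; simp add: field_simps)+
  have "(\<lambda>\<epsilon>. enn2real ((transport_dist E w \<pi> \<mu> (\<mu> + \<epsilon> *\<^sub>R h))\<^sup>2)
             - \<bar>\<epsilon>\<bar>\<^sup>2 * (h \<bullet> (pinv L *v h))) \<in> o[at 0](\<lambda>\<epsilon>. \<bar>\<epsilon>\<bar>\<^sup>2)"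
    if h: "h \<in> zero_sum_vectors" "norm h \<le> 1" for h
  proof (rule smallo_square_of_two_sided_bound[of "1 / C" C C'])
    have Q: "0 \<le> h \<bullet> (pinv L *v h)"
      unfolding L by (rule laplacian_pinv_form(1)[OF wg\<mu> connected h(1)])
    then show "0 \<le> h \<bullet> (pinv L *v h)" .
    fix \<epsilon> :: real assume \<epsilon>: "\<bar>\<epsilon>\<bar> < 1 / C"
    let ?l = "\<epsilon>\<^sup>2 / (1 + C' * \<bar>\<epsilon>\<bar>) * (h \<bullet> (pinv L *v h))"
      and ?u = "\<epsilon>\<^sup>2 / (1 - C * \<bar>\<epsilon>\<bar>) * (h \<bullet> (pinv L *v h))"
    have "C * \<bar>\<epsilon>\<bar> < 1" "0 \<le> C' * \<bar>\<epsilon>\<bar>"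
      using \<epsilon> C_pos CC' by (simp_all add: field_simps)
    then have "0 \<le> ?l" "0 \<le> ?u"
      using Q by simp_all
    with bounds[OF h \<epsilon>] show "?l \<le> enn2real ((transport_dist E w \<pi> \<mu> (\<mu> + \<epsilon> *\<^sub>R h))\<^sup>2) \<and>
        enn2real ((transport_dist E w \<pi> \<mu> (\<mu> + \<epsilon> *\<^sub>R h))\<^sup>2) \<le> ?u"
      \<comment> \<open>The finite upper bound excludes the value \<open>\<infinity>\<close>, so
        \<open>enn2real\<close> preserves both inequalities.\<close>
      by (cases "(transport_dist E w \<pi> \<mu> (\<mu> + \<epsilon> *\<^sub>R h))\<^sup>2" rule: ennreal_cases)
        (auto simp: top_unique)
  qed (use C_pos CC' in auto)
  then show ?thesis
    using C_pos CC' bounds by (intro conjI exI[of _ "1 / C"]) auto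
qed

end
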